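(* Let $K$ be a field of characteristic $0$, let $H=H[a_i]$ be the Heisenberg algebra over $K$ with non-zero parameters $a_i$, and let $V$ be a graded representation of $H$ with distinguished homogeneous basis $\{v_s : s\in S\}$ as described in the context. Let $b\in S$ be such that $v_b$ is a highest weight vector for $H$, and set $F_s:=F_{s/b}$, $G_s := G_{s/b}$ for $s\in S$. Let $k\ge 1$. Then for every $s\in S$ the following identities hold in $\Lambda_K$ (sums over $t\in S$): $$h_k[a_i]\,G_s=\sum_{t}\langle U_k\cdot v_s,v_t\rangle\,G_t,\qquad h_k[a_i]\,F_s=\sum_t\langle D_k\cdot v_t,v_s\rangle\,F_t.$$ The dual identities are: $$h_k^\perp G_s=\sum_t\langle D_k\cdot v_s,v_t\rangle\,G_t,\qquad h_k^\perp F_s=\sum_t\langle U_k\cdot v_t,v_s\rangle\,F_t.$$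
   Context: Symmetric functions: $\Lambda_K$ is the ring of symmetric functions over $K$ in $x_1,x_2,\ldots$; $h_k$ and $p_k$ are the complete homogeneous and power sum symmetric functions. The Hall inner product on $\Lambda_K$ is the bilinear form with $\langle p_\lambda,p_\mu\rangle=\delta_{\lambda\mu}z_\lambda$, and $h_k^\perp$ is the linear operator on $\Lambda_K$ adjoint to multiplication by $h_k$ with respect to it. $h_k[a_i]:=\theta(h_k)$, where $\theta$ is the algebra homomorphism into $\Lambda_K$ with $\theta(p_j)=a_jp_j$ for $j\ge 1$. Partitions: for a partition $\lambda$, $m_i(\lambda)$ is the number of parts equal to $i$, and $z_\lambda=\prod_{i\ge1} i^{m_i(\lambda)}m_i(\lambda)!$. Heisenberg algebra: given non-zero parameters $a_k\in K$ ($k\in\mathbb Z\setminus\{0\}$) with $a_k=a_{-k}$, $H=H[a_i]$ is the unital associative $K$-algebra generated by $\{B_k: k\in\mathbb Z\setminus\{0\}\}$ with relations $[B_k,B_l]=k\,a_k\,\delta_{k,-l}$. For a partition $\lambda=(\lambda_1,\ldots,\lambda_l)$ put $B_\lambda=B_{\lambda_1}\cdots B_{\lambda_l}$ and $B_{-\lambda}=B_{-\lambda_1}\cdots B_{-\lambda_l}$; for $k\ge 0$ put $D_k=\sum_{\lambda\vdash k}z_\lambda^{-1}B_\lambda$ and $U_k=\sum_{\lambda\vdash k}z_\lambda^{-1}B_{-\lambda}$ (so $D_0=U_0=1$). Representation: $V$ is a representation of $H$ with a distinguished basis $\{v_s: s\in S\}$. Both $V$ and $S$ are $\mathbb Z$-graded,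 each $v_s$ is homogeneous with $\deg(v_s)=\deg(s)$, each graded component of $V$ is finite-dimensional, and the action is graded in the sense that $\deg(B_k)=-mk$ for some fixed $m\in\mathbb Z\setminus\{0\}$. The inner product $\langle\cdot,\cdot\rangle:V\times V\to K$ is the bilinear form with $\langle v_s,v_{s'}\rangle=\delta_{ss'}$. A vector $v\in V$ is a highest weight vector if $B_k\cdot v=0$ for all $k>0$. Generating functions: for $s,t\in S$, $$F_{s/t}=\sum_\alpha x^\alpha\langle U_{\alpha_l}\cdots U_{\alpha_1}\cdot v_t,v_s\rangle,\qquad G_{s/t}=\sum_\alpha x^\alpha\langle D_{\alpha_l}\cdots D_{\alpha_1}\cdot v_s,v_t\rangle,$$ where $\alpha=(\alpha_1,\alpha_2,\ldots)$ runs over sequences of non-negative integers with finitely many non-zero terms and $x^\alpha=\prod_i x_i^{\alpha_i}$. These are symmetric functions, homogeneous of degree $(\deg(s)-\deg(t))/m$ (zero if this is negative or non-integral).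
   Formalization: The first identity, for h_k[a_i] G_s, is false as stated; it is proved under the extra condition that ⟨B_{-j}·x, v_b⟩ = 0 for all j > 0 and x in V, which is necessary for it to hold for all k and s. The other three identities are as stated. *)

theory Defs
  imports
    "HOL-Library.Poly_Mapping"
    "HOL-Library.Multiset"
    "HOL-Algebra.Algebraic_Closure_Type"
begin

section \<open>Symmetric functions\<close>

text \<open>
  The exponent \<open>\<alpha> :: nat \<Rightarrow>\<^sub>0 nat\<close> stands for the monomial \<open>x\<^sup>\<alpha>\<close> in countably many variables
  (numbered from 0). A formal power series is its function of coefficients; a symmetric function
  is a power series of bounded degree that is invariant under permuting the variables.
\<close>

definition expo_deg :: "(nat \<Rightarrow>\<^sub>0 nat) \<Rightarrow> nat" where
  "expo_deg \<alpha> = (\<Sum>i\<in>Poly_Mapping.keys \<alpha>. Poly_Mapping.lookup \<alpha> i)"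

definition is_symfun :: "((nat \<Rightarrow>\<^sub>0 nat) \<Rightarrow> 'a::comm_ring_1) \<Rightarrow> bool" where
  "is_symfun f \<longleftrightarrow>
     (\<exists>d. \<forall>\<alpha>. f \<alpha> \<noteq> 0 \<longrightarrow> expo_deg \<alpha> \<le> d) \<and>
     (\<forall>\<pi> \<alpha>. bij \<pi> \<longrightarrow> f (Poly_Mapping.map_key \<pi> \<alpha>) = f \<alpha>)"

definition expo_splits :: "(nat \<Rightarrow>\<^sub>0 nat) \<Rightarrow> ((nat \<Rightarrow>\<^sub>0 nat) \<times> (nat \<Rightarrow>\<^sub>0 nat)) set" where
  "expo_splits \<alpha> = {(\<beta>, \<gamma>). \<beta> + \<gamma> = \<alpha>}"

definition series_mult ::
  "((nat \<Rightarrow>\<^sub>0 nat) \<Rightarrow> 'a::comm_ring_1) \<Rightarrow> ((nat \<Rightarrow>\<^sub>0 nat) \<Rightarrow> 'a) \<Rightarrow> (nat \<Rightarrow>\<^sub>0 nat) \<Rightarrow> 'a" where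
  "series_mult f g \<alpha> = (\<Sum>(\<beta>, \<gamma>)\<in>expo_splits \<alpha>. f \<beta> * g \<gamma>)"

lemma expo_deg_superset:
  assumes "finite A" "Poly_Mapping.keys \<alpha> \<subseteq> A"
  shows "expo_deg \<alpha> = (\<Sum>i\<in>A. Poly_Mapping.lookup \<alpha> i)"
  unfolding expo_deg_def using assms
  by (intro sum.mono_neutral_left) (auto simp: in_keys_iff)

lemma expo_deg_add: "expo_deg (\<alpha> + \<beta>) = expo_deg \<alpha> + expo_deg \<beta>"
proof -
  let ?A = "Poly_Mapping.keys \<alpha> \<union> Poly_Mapping.keys \<beta>"
  have "expo_deg (\<alpha> + \<beta>) = (\<Sum>i\<in>?A. Poly_Mapping.lookup (\<alpha> + \<beta>) i)"
    by (rule expo_deg_superset) (auto dest: subsetD[OF Poly_Mapping.keys_add])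
  also have "\<dots> = (\<Sum>i\<in>?A. Poly_Mapping.lookup \<alpha> i) + (\<Sum>i\<in>?A. Poly_Mapping.lookup \<beta> i)"
    by (simp add: lookup_add sum.distrib)
  also have "\<dots> = expo_deg \<alpha> + expo_deg \<beta>"
    using expo_deg_superset[of ?A \<alpha>] expo_deg_superset[of ?A \<beta>] by simp
  finally show ?thesis .
qed

lemma expo_deg_zero [simp]: "expo_deg 0 = 0"
  by (simp add: expo_deg_def)

lemma expo_deg_single [simp]: "expo_deg (Poly_Mapping.single i k) = k"
  by (cases "k = 0") (simp_all add: expo_deg_def)

lemma expo_deg_map_key:
  assumes "bij \<pi>" shows "expo_deg (Poly_Mapping.map_key \<pi> \<alpha>) = expo_deg \<alpha>"
proof -
  have inj: "inj \<pi>" using assms by (rule bij_is_inj)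
  have "expo_deg (Poly_Mapping.map_key \<pi> \<alpha>)
      = (\<Sum>i\<in>\<pi> -` Poly_Mapping.keys \<alpha>. Poly_Mapping.lookup \<alpha> (\<pi> i))"
    by (simp add: expo_deg_def keys_map_key[OF inj] map_key.rep_eq[of \<pi>] inj)
  also have "\<dots> = expo_deg \<alpha>"
    unfolding expo_deg_def
    by (rule sum.reindex_bij_betw)
       (use assms in \<open>auto simp: bij_betw_def inj_on_def bij_def surj_def image_iff\<close>)
  finally show ?thesis .
qed

lemma map_key_inv:
  assumes "bij \<pi>"
  shows "Poly_Mapping.map_key \<pi> (Poly_Mapping.map_key (inv_into UNIV \<pi>) \<alpha>) = \<alpha>"
    and "Poly_Mapping.map_key (inv_into UNIV \<pi>) (Poly_Mapping.map_key \<pi> \<alpha>) = \<alpha>"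
proof -
  have i: "inj \<pi>" "inj (inv_into UNIV \<pi>)"
    using assms bij_imp_bij_inv[OF assms] by (auto dest: bij_is_inj)
  have "inv_into UNIV \<pi> \<circ> \<pi> = (\<lambda>x. x)" "\<pi> \<circ> inv_into UNIV \<pi> = (\<lambda>x. x)"
    using assms by (auto simp: fun_eq_iff bij_def surj_f_inv_f)
  then show "Poly_Mapping.map_key \<pi> (Poly_Mapping.map_key (inv_into UNIV \<pi>) \<alpha>) = \<alpha>"
    "Poly_Mapping.map_key (inv_into UNIV \<pi>) (Poly_Mapping.map_key \<pi> \<alpha>) = \<alpha>"
    using map_key_compose[OF i(1) i(2)] map_key_compose[OF i(2) i(1)]
    by (simp_all add: map_key_id)
qed

lemma finite_expo_splits [simp]: "finite (expo_splits \<alpha>)"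
proof -
  let ?A = "Poly_Mapping.keys \<alpha>"
  let ?B = "{..expo_deg \<alpha>}"
  let ?F = "{f. \<forall>x. (x \<in> ?A \<longrightarrow> f x \<in> ?B) \<and> (x \<notin> ?A \<longrightarrow> f x = (0::nat))}"
  have fin: "finite ?F" by (rule finite_set_of_finite_funs) auto
  have le: "Poly_Mapping.lookup \<alpha> x \<le> expo_deg \<alpha>" if "x \<in> ?A" for x
    unfolding expo_deg_def using that by (intro member_le_sum) auto
  have "(\<lambda>(\<beta>, \<gamma>). (Poly_Mapping.lookup \<beta>, Poly_Mapping.lookup \<gamma>)) ` expo_splits \<alpha> \<subseteq> ?F \<times> ?F"
  proof (clarsimp simp: expo_splits_def, intro conjI allI impI)
    fix \<beta> \<gamma> :: "nat \<Rightarrow>\<^sub>0 nat" and x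
    assume a: "\<alpha> = \<beta> + \<gamma>"
    { assume "x \<in> Poly_Mapping.keys (\<beta> + \<gamma>)"
      with le[of x] a show "Poly_Mapping.lookup \<beta> x \<le> expo_deg (\<beta> + \<gamma>)"
        "Poly_Mapping.lookup \<gamma> x \<le> expo_deg (\<beta> + \<gamma>)" by (auto simp: lookup_add) }
    { assume "x \<notin> Poly_Mapping.keys (\<beta> + \<gamma>)"
      then show "Poly_Mapping.lookup \<beta> x = 0" "Poly_Mapping.lookup \<gamma> x = 0"
        by (auto simp: in_keys_iff lookup_add) }
  qed
  then have "finite ((\<lambda>(\<beta>, \<gamma>). (Poly_Mapping.lookup \<beta>, Poly_Mapping.lookup \<gamma>)) ` expo_splits \<alpha>)"
    using fin finite_subset by blast
  moreover have "inj_on (\<lambda>(\<beta>, \<gamma>). (Poly_Mapping.lookup \<beta>, Poly_Mapping.lookup \<gamma>)) (expo_splits \<alpha>)"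
    by (auto simp: inj_on_def)
  ultimately show ?thesis by (rule finite_imageD)
qed

lemma series_mult_commute: "series_mult f g = series_mult g f"
  unfolding series_mult_def fun_eq_iff
  by (intro allI sum.reindex_bij_witness[where i = prod.swap and j = prod.swap])
     (auto simp: expo_splits_def add.commute mult.commute)

lemma series_mult_assoc: "series_mult (series_mult f g) h = series_mult f (series_mult g h)"
proof
  fix \<alpha>
  have "series_mult (series_mult f g) h \<alpha> =
     (\<Sum>(x, y)\<in>Sigma (expo_splits \<alpha>) (\<lambda>x. expo_splits (fst x)). f (fst y) * g (snd y) * h (snd x))"
    unfolding series_mult_def
    by (subst sum.Sigma[symmetric]) (auto simp: sum_distrib_right case_prod_unfold)
  also have "\<dots> =
     (\<Sum>(x, y)\<in>Sigma (expo_splits \<alpha>) (\<lambda>x. expo_splits (snd x)). f (fst x) * (g (fst y) * h (snd y)))"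
    by (rule sum.reindex_bij_witness
          [where i = "\<lambda>((b, d), (c, e)). ((b + c, e), (b, c))"
             and j = "\<lambda>((d, e), (b, c)). ((b, c + e), (c, e))"])
       (auto simp: expo_splits_def algebra_simps)
  also have "\<dots> = series_mult f (series_mult g h) \<alpha>"
    unfolding series_mult_def
    by (subst sum.Sigma[symmetric]) (auto simp: sum_distrib_left case_prod_unfold)
  finally show "series_mult (series_mult f g) h \<alpha> = series_mult f (series_mult g h) \<alpha>" .
qed

lemma series_mult_one: "series_mult (\<lambda>\<alpha>. if \<alpha> = 0 then 1 else 0) f = f"
proof
  fix \<alpha>
  have eq: "(case x of (\<beta>, \<gamma>) \<Rightarrow> (if \<beta> = 0 then 1 else 0) * f \<gamma>) = (if x = (0, \<alpha>) then f \<alpha> else 0)"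
    if "x \<in> expo_splits \<alpha>" for x
  proof (cases "fst x = 0")
    case True
    with that have "x = (0, \<alpha>)" by (simp add: expo_splits_def case_prod_unfold prod_eq_iff)
    then show ?thesis by simp
  next
    case False
    then have "x \<noteq> (0, \<alpha>)" by (metis fst_conv)
    with False show ?thesis by (simp add: case_prod_unfold)
  qed
  have "(0, \<alpha>) \<in> expo_splits \<alpha>" by (simp add: expo_splits_def)
  then show "series_mult (\<lambda>\<alpha>. if \<alpha> = 0 then 1 else 0) f \<alpha> = f \<alpha>"
    unfolding series_mult_def by (simp add: sum.cong[OF refl eq])
qed

lemma series_mult_add: "series_mult (\<lambda>\<alpha>. f \<alpha> + g \<alpha>) h = (\<lambda>\<alpha>. series_mult f h \<alpha> + series_mult g h \<alpha>)"
  by (simp add: fun_eq_iff series_mult_def case_prod_unfold algebra_simps sum.distrib)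

lemma is_symfun_mult:
  assumes "is_symfun f" "is_symfun g" shows "is_symfun (series_mult f g)"
  unfolding is_symfun_def
proof (intro conjI allI impI)
  from assms obtain d e where
    d: "\<And>\<alpha>. f \<alpha> \<noteq> 0 \<Longrightarrow> expo_deg \<alpha> \<le> d" and e: "\<And>\<alpha>. g \<alpha> \<noteq> 0 \<Longrightarrow> expo_deg \<alpha> \<le> e"
    unfolding is_symfun_def by metis
  have "expo_deg \<alpha> \<le> d + e" if nz: "series_mult f g \<alpha> \<noteq> 0" for \<alpha>
  proof -
    obtain x where "x \<in> expo_splits \<alpha>" "(case x of (\<beta>, \<gamma>) \<Rightarrow> f \<beta> * g \<gamma>) \<noteq> 0"
      using nz unfolding series_mult_def by (rule sum.not_neutral_contains_not_neutral)
    then have x: "\<alpha> = fst x + snd x" "f (fst x) * g (snd x) \<noteq> 0"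
      by (simp_all add: expo_splits_def case_prod_unfold)
    then have "f (fst x) \<noteq> 0" "g (snd x) \<noteq> 0" by (metis mult_zero_left, metis mult_zero_right)
    with d[of "fst x"] e[of "snd x"] x(1) show ?thesis by (simp add: expo_deg_add)
  qed
  then show "\<exists>d. \<forall>\<alpha>. series_mult f g \<alpha> \<noteq> 0 \<longrightarrow> expo_deg \<alpha> \<le> d" by blast
next
  fix \<pi> :: "nat \<Rightarrow> nat" and \<alpha>
  assume b: "bij \<pi>"
  note b' = bij_imp_bij_inv[OF b]
  let ?m = "Poly_Mapping.map_key \<pi>" and ?n = "Poly_Mapping.map_key (inv_into UNIV \<pi>)"
  have f: "f (?n x) = f x" and g: "g (?n x) = g x" for x
    using assms b' by (auto simp: is_symfun_def)
  have add: "?m (x + y) = ?m x + ?m y" "?n (x + y) = ?n x + ?n y" for x y :: "nat \<Rightarrow>\<^sub>0 nat"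
    using b b' by (auto intro!: map_key_plus bij_is_inj)
  show "series_mult f g (?m \<alpha>) = series_mult f g \<alpha>"
    unfolding series_mult_def
    by (rule sum.reindex_bij_witness[where j = "map_prod ?n ?n" and i = "map_prod ?m ?m"])
       (auto simp: expo_splits_def map_key_inv[OF b] add[symmetric] f g)
qed

typedef (overloaded) 'a symfun = "{f :: (nat \<Rightarrow>\<^sub>0 nat) \<Rightarrow> 'a::comm_ring_1. is_symfun f}"
  morphisms symfun_coeff Abs_symfun
  by (rule exI[of _ "\<lambda>_. 0"]) (simp add: is_symfun_def)

setup_lifting type_definition_symfun

lemma is_symfun_add:
  assumes "is_symfun f" "is_symfun g" shows "is_symfun (\<lambda>\<alpha>. f \<alpha> + g \<alpha>)"
proof -
  from assms obtain d e where
    d: "\<And>\<alpha>. f \<alpha> \<noteq> 0 \<Longrightarrow> expo_deg \<alpha> \<le> d" and e: "\<And>\<alpha>. g \<alpha> \<noteq> 0 \<Longrightarrow> expo_deg \<alpha> \<le> e"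
    unfolding is_symfun_def by metis
  have "f \<alpha> + g \<alpha> \<noteq> 0 \<longrightarrow> expo_deg \<alpha> \<le> max d e" for \<alpha>
    using d[of \<alpha>] e[of \<alpha>] by (cases "f \<alpha> = 0") auto
  then show ?thesis
    using assms unfolding is_symfun_def by (metis (no_types, lifting))
qed

instantiation symfun :: (comm_ring_1) comm_ring_1
begin

lift_definition zero_symfun :: "'a symfun" is "\<lambda>_. 0"
  by (simp add: is_symfun_def)

lift_definition one_symfun :: "'a symfun" is "\<lambda>\<alpha>. if \<alpha> = 0 then 1 else 0"
proof -
  have "Poly_Mapping.map_key \<pi> \<alpha> = 0 \<longleftrightarrow> \<alpha> = 0" if "bij \<pi>" for \<pi> :: "nat \<Rightarrow> nat" and \<alpha> :: "nat \<Rightarrow>\<^sub>0 nat"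
    using map_key_inv[OF that] bij_is_inj[OF that] bij_is_inj[OF bij_imp_bij_inv[OF that]]
    by (metis map_key_zero)
  then show "is_symfun (\<lambda>\<alpha>. if \<alpha> = 0 then 1 else 0 :: 'a)"
    by (auto simp: is_symfun_def)
qed

lift_definition plus_symfun :: "'a symfun \<Rightarrow> 'a symfun \<Rightarrow> 'a symfun" is "\<lambda>f g \<alpha>. f \<alpha> + g \<alpha>"
  by (rule is_symfun_add)

lift_definition uminus_symfun :: "'a symfun \<Rightarrow> 'a symfun" is "\<lambda>f \<alpha>. - f \<alpha>"
  by (simp add: is_symfun_def)

definition minus_symfun :: "'a symfun \<Rightarrow> 'a symfun \<Rightarrow> 'a symfun" where
  "minus_symfun f g = f + - g"

lift_definition times_symfun :: "'a symfun \<Rightarrow> 'a symfun \<Rightarrow> 'a symfun" is series_mult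
  by (rule is_symfun_mult)

instance
proof
  fix a b c :: "'a symfun"
  show "a * b * c = a * (b * c)" by transfer (rule series_mult_assoc)
  show "a * b = b * a" by transfer (rule series_mult_commute)
  show "1 * a = a" by transfer (rule series_mult_one)
  show "(a + b) * c = a * c + b * c" by transfer (rule series_mult_add)
  show "a + b + c = a + (b + c)" by transfer (simp add: add.assoc)
  show "a + b = b + a" by transfer (simp add: add.commute)
  show "0 + a = a" by transfer simp
  show "- a + a = 0" by transfer simp
  show "a - b = a + - b" by (rule minus_symfun_def)
  show "(0::'a symfun) \<noteq> 1" by transfer (metis zero_neq_one)
qed

end

lift_definition symfun_scale :: "'a::comm_ring_1 \<Rightarrow> 'a symfun \<Rightarrow> 'a symfun" is "\<lambda>c f \<alpha>. c * f \<alpha>"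
proof -
  fix c :: 'a and f :: "(nat \<Rightarrow>\<^sub>0 nat) \<Rightarrow> 'a"
  assume f: "is_symfun f"
  then obtain d where "\<And>\<alpha>. f \<alpha> \<noteq> 0 \<Longrightarrow> expo_deg \<alpha> \<le> d"
    unfolding is_symfun_def by blast
  then have "\<forall>\<alpha>. c * f \<alpha> \<noteq> 0 \<longrightarrow> expo_deg \<alpha> \<le> d" by (metis mult_zero_right)
  with f show "is_symfun (\<lambda>\<alpha>. c * f \<alpha>)"
    unfolding is_symfun_def by auto
qed

interpretation symfun: vector_space "symfun_scale :: 'k::field \<Rightarrow> 'k symfun \<Rightarrow> 'k symfun"
  by unfold_locales (transfer; simp add: algebra_simps)+

lift_definition h_sym :: "nat \<Rightarrow> 'a::comm_ring_1 symfun" is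
  "\<lambda>k \<alpha>. if expo_deg \<alpha> = k then 1 else 0"
  by (auto simp: is_symfun_def expo_deg_map_key)

lift_definition p_sym :: "nat \<Rightarrow> 'a::comm_ring_1 symfun" is
  "\<lambda>k \<alpha>. if \<exists>i. \<alpha> = Poly_Mapping.single i k then 1 else 0"
proof -
  fix k :: nat
  have s: "\<exists>j. Poly_Mapping.map_key \<pi> (Poly_Mapping.single i k) = Poly_Mapping.single j k"
    if "bij \<pi>" for \<pi> :: "nat \<Rightarrow> nat" and i
    using map_key_single[OF bij_is_inj[OF that], of "inv_into UNIV \<pi> i" k] that
    by (metis bij_inv_eq_iff)
  have eq: "(\<exists>i. Poly_Mapping.map_key \<pi> \<alpha> = Poly_Mapping.single i k) \<longleftrightarrow>
      (\<exists>i. \<alpha> = Poly_Mapping.single i k)"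
    if b: "bij \<pi>" for \<pi> :: "nat \<Rightarrow> nat" and \<alpha>
    using s[OF b] s[OF bij_imp_bij_inv[OF b]] map_key_inv[OF b] by metis
  show "is_symfun (\<lambda>\<alpha>. if \<exists>i. \<alpha> = Poly_Mapping.single i k then 1 else 0 :: 'a)"
    unfolding is_symfun_def
  proof (intro conjI allI impI)
    show "\<exists>d. \<forall>\<alpha>. (if \<exists>i. \<alpha> = Poly_Mapping.single i k then 1 else 0 :: 'a) \<noteq> 0 \<longrightarrow> expo_deg \<alpha> \<le> d"
      by (rule exI[of _ k]) (auto split: if_splits)
  qed (simp add: eq)
qed

section \<open>Partitions, Hall inner product\<close>

definition is_partition :: "nat list \<Rightarrow> bool" where
  "is_partition \<mu> \<longleftrightarrow> sorted_wrt (\<ge>) \<mu> \<and> 0 \<notin> set \<mu>"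

definition partitions_of :: "nat \<Rightarrow> nat list set" where
  "partitions_of k = {\<mu>. is_partition \<mu> \<and> sum_list \<mu> = k}"

definition z_part :: "nat list \<Rightarrow> nat" where
  "z_part \<mu> = (\<Prod>i\<in>set \<mu>. i ^ count_list \<mu> i * fact (count_list \<mu> i))"

definition p_part :: "nat list \<Rightarrow> 'a::comm_ring_1 symfun" where
  "p_part \<mu> = prod_list (map p_sym \<mu>)"

definition bilinear_form :: "('k::field \<Rightarrow> 'v::ab_group_add \<Rightarrow> 'v) \<Rightarrow> ('v \<Rightarrow> 'v \<Rightarrow> 'k) \<Rightarrow> bool" where
  "bilinear_form scale f \<longleftrightarrow>
     (\<forall>u. Vector_Spaces.linear scale (*) (f u)) \<and>
     (\<forall>w. Vector_Spaces.linear scale (*) (\<lambda>u. f u w))"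

text \<open>
  The \<open>p_part\<close> of partitions form a basis of the symmetric functions in characteristic 0, so
  the definite descriptions below denote.
\<close>

definition hall_inner :: "'k::field_char_0 symfun \<Rightarrow> 'k symfun \<Rightarrow> 'k" where
  "hall_inner = (THE f. bilinear_form symfun_scale f \<and>
     (\<forall>\<mu> \<nu>. is_partition \<mu> \<longrightarrow> is_partition \<nu> \<longrightarrow>
        f (p_part \<mu>) (p_part \<nu>) = (if \<mu> = \<nu> then of_nat (z_part \<mu>) else 0)))"

definition h_perp :: "nat \<Rightarrow> 'k::field_char_0 symfun \<Rightarrow> 'k symfun" where
  "h_perp k = (THE T. Vector_Spaces.linear symfun_scale symfun_scale T \<and>
     (\<forall>f g. hall_inner (T f) g = hall_inner f (h_sym k * g)))"

definition plethysm_hom :: "(int \<Rightarrow> 'k::field_char_0) \<Rightarrow> 'k symfun \<Rightarrow> 'k symfun" where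
  "plethysm_hom a = (THE \<theta>. Vector_Spaces.linear symfun_scale symfun_scale \<theta> \<and>
     \<theta> 1 = 1 \<and> (\<forall>f g. \<theta> (f * g) = \<theta> f * \<theta> g) \<and>
     (\<forall>j\<ge>1. \<theta> (p_sym j) = symfun_scale (a (int j)) (p_sym j)))"

section \<open>The Heisenberg algebra\<close>

text \<open>
  Words in the non-zero integers form the free monoid on the generators, so
  \<open>heis_word \<Rightarrow>\<^sub>0 'k\<close> is the free unital associative algebra on them.
\<close>

typedef heis_word = "{w :: int list. 0 \<notin> set w}"
  by (rule exI[of _ "[]"]) simp

setup_lifting type_definition_heis_word

instantiation heis_word :: monoid_add
begin

lift_definition zero_heis_word :: heis_word is "[]"
  by simp

lift_definition plus_heis_word :: "heis_word \<Rightarrow> heis_word \<Rightarrow> heis_word" is "(@)"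
  by simp

instance
  by intro_classes (transfer; simp)+

end

type_synonym 'k free_heis = "heis_word \<Rightarrow>\<^sub>0 'k"

definition free_gen :: "int \<Rightarrow> 'k::field free_heis" where
  "free_gen k = Poly_Mapping.single (Abs_heis_word [k]) 1"

definition free_const :: "'k::field \<Rightarrow> 'k free_heis" where
  "free_const c = Poly_Mapping.single 0 c"

definition heis_relators :: "(int \<Rightarrow> 'k::field) \<Rightarrow> 'k free_heis set" where
  "heis_relators a =
     {free_gen k * free_gen l - free_gen l * free_gen k
        - free_const (if k = - l then of_int k * a k else 0) | k l. k \<noteq> 0 \<and> l \<noteq> 0}"

definition heis_ideal :: "(int \<Rightarrow> 'k::field) \<Rightarrow> 'k free_heis set" where
  "heis_ideal a = Idl\<^bsub>ring_of_type_algebra\<^esub> (heis_relators a)"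

definition heis_alg :: "(int \<Rightarrow> 'k::field) \<Rightarrow> 'k free_heis set ring" where
  "heis_alg a = ring_of_type_algebra Quot heis_ideal a"

definition heis_class :: "(int \<Rightarrow> 'k::field) \<Rightarrow> 'k free_heis \<Rightarrow> 'k free_heis set" where
  "heis_class a x = heis_ideal a +>\<^bsub>ring_of_type_algebra\<^esub> x"

definition heis_B :: "(int \<Rightarrow> 'k::field) \<Rightarrow> int \<Rightarrow> 'k free_heis set" where
  "heis_B a k = heis_class a (free_gen k)"

definition heis_D :: "(int \<Rightarrow> 'k::field_char_0) \<Rightarrow> nat \<Rightarrow> 'k free_heis set" where
  "heis_D a k = heis_class a (\<Sum>\<mu>\<in>partitions_of k.
     free_const (inverse (of_nat (z_part \<mu>))) * prod_list (map (\<lambda>i. free_gen (int i)) \<mu>))"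

definition heis_U :: "(int \<Rightarrow> 'k::field_char_0) \<Rightarrow> nat \<Rightarrow> 'k free_heis set" where
  "heis_U a k = heis_class a (\<Sum>\<mu>\<in>partitions_of k.
     free_const (inverse (of_nat (z_part \<mu>))) * prod_list (map (\<lambda>i. free_gen (- int i)) \<mu>))"

section \<open>Graded representations\<close>

definition endo_ring :: "('k::field \<Rightarrow> 'v::ab_group_add \<Rightarrow> 'v) \<Rightarrow> ('v \<Rightarrow> 'v) ring" where
  "endo_ring scale = \<lparr>carrier = {f. Vector_Spaces.linear scale scale f}, monoid.mult = (\<circ>),
     one = id, ring.zero = (\<lambda>_. 0), add = (\<lambda>f g x. f x + g x)\<rparr>"

text \<open>
  \<open>\<rho>\<close> is the representation, \<open>Vgr n\<close> the component of \<open>V\<close> of degree \<open>n\<close>, \<open>v\<close> the distinguished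
  basis (indexed by the whole type \<open>'s\<close>), and \<open>ip\<close> the inner product making it orthonormal.
\<close>

locale graded_heis_rep = vector_space scale
  for scale :: "'k::field_char_0 \<Rightarrow> 'v::ab_group_add \<Rightarrow> 'v" +
  fixes a :: "int \<Rightarrow> 'k"
    and \<rho> :: "'k free_heis set \<Rightarrow> 'v \<Rightarrow> 'v"
    and Vgr :: "int \<Rightarrow> 'v set"
    and v :: "'s \<Rightarrow> 'v"
    and deg :: "'s \<Rightarrow> int"
    and m :: int
    and ip :: "'v \<Rightarrow> 'v \<Rightarrow> 'k"
  assumes rep_ring_hom: "\<rho> \<in> ring_hom (heis_alg a) (endo_ring scale)"
    and rep_scalar: "\<rho> (heis_class a (free_const c)) = scale c"
    and basis_inj: "inj v"
    and basis_independent: "independent (range v)"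
    and basis_span: "span (range v) = UNIV"
    and graded_subspace: "subspace (Vgr n)"
    and graded_decomposition:
      "\<exists>!f :: int \<Rightarrow> 'v. (\<forall>n. f n \<in> Vgr n) \<and> finite {n. f n \<noteq> 0} \<and> x = Sum_any f"
    and graded_finite_dim: "\<exists>A. finite A \<and> Vgr n \<subseteq> span A"
    and basis_homogeneous: "v s \<in> Vgr (deg s)"
    and shift_nonzero: "m \<noteq> 0"
    and rep_graded: "k \<noteq> 0 \<Longrightarrow> x \<in> Vgr n \<Longrightarrow> \<rho> (heis_B a k) x \<in> Vgr (n - m * k)"
    and ip_bilinear: "bilinear_form scale ip"
    and ip_basis: "ip (v s) (v t) = (if s = t then 1 else 0)"

definition highest_weight ::
  "(int \<Rightarrow> 'k::field) \<Rightarrow> ('k free_heis set \<Rightarrow> 'v::zero \<Rightarrow> 'v) \<Rightarrow> 'v \<Rightarrow> bool" where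
  "highest_weight a \<rho> x \<longleftrightarrow> (\<forall>k>0. \<rho> (heis_B a k) x = 0)"

text \<open>
  A highest weight basis vector \<open>v b\<close> need not satisfy this: let \<open>z\<close> be a highest weight vector one
  step below another one \<open>v b\<close>, in a direct sum of two Fock spaces, and use \<open>v b\<close> and
  \<open>B\<^sub>-\<^sub>1 z + v b\<close> as basis of the span of \<open>v b\<close> and \<open>B\<^sub>-\<^sub>1 z\<close>; then \<open>B\<^sub>-\<^sub>1 z\<close> has
  coefficient \<open>-1\<close> at \<open>v b\<close>. Since the constant term of \<open>h\<^sub>k[a] G\<^sub>s\<close> is 0 for \<open>k \<ge> 1\<close> and that of
  \<open>\<Sum>t. \<langle>U\<^sub>k v\<^sub>s, v\<^sub>t\<rangle> G\<^sub>t\<close> is \<open>\<langle>U\<^sub>k v\<^sub>s, v\<^sub>b\<rangle>\<close>, the two agree for all \<open>k\<close> and \<open>s\<close> only under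
  this condition.
\<close>

definition dual_highest_weight ::
  "(int \<Rightarrow> 'k::field) \<Rightarrow> ('k free_heis set \<Rightarrow> 'v \<Rightarrow> 'v) \<Rightarrow> ('v \<Rightarrow> 'v \<Rightarrow> 'k) \<Rightarrow> 'v \<Rightarrow> bool" where
  "dual_highest_weight a \<rho> ip x \<longleftrightarrow> (\<forall>k>0. \<forall>y. ip (\<rho> (heis_B a (- k)) y) x = 0)"

text \<open>
  In the following, \<open>fold\<close> applies the operator for the first entry of \<open>\<alpha>\<close> first; all entries from
  \<open>Poly_Mapping.degree \<alpha>\<close> on are 0. For a graded representation both series satisfy \<open>is_symfun\<close>:
  the \<open>U\<close>s commute with each other, so do the \<open>D\<close>s, and the grading bounds the degree.
\<close>

definition F_skew :: "(int \<Rightarrow> 'k::field_char_0) \<Rightarrow> ('k free_heis set \<Rightarrow> 'v \<Rightarrow> 'v) \<Rightarrow>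
    ('v \<Rightarrow> 'v \<Rightarrow> 'k) \<Rightarrow> ('s \<Rightarrow> 'v) \<Rightarrow> 's \<Rightarrow> 's \<Rightarrow> 'k symfun" where
  "F_skew a \<rho> ip v s t = Abs_symfun (\<lambda>\<alpha>.
     ip (fold (\<lambda>i. \<rho> (heis_U a (Poly_Mapping.lookup \<alpha> i))) [0..<Poly_Mapping.degree \<alpha>] (v t)) (v s))"

definition G_skew :: "(int \<Rightarrow> 'k::field_char_0) \<Rightarrow> ('k free_heis set \<Rightarrow> 'v \<Rightarrow> 'v) \<Rightarrow>
    ('v \<Rightarrow> 'v \<Rightarrow> 'k) \<Rightarrow> ('s \<Rightarrow> 'v) \<Rightarrow> 's \<Rightarrow> 's \<Rightarrow> 'k symfun" where
  "G_skew a \<rho> ip v s t = Abs_symfun (\<lambda>\<alpha>.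
     ip (fold (\<lambda>i. \<rho> (heis_D a (Poly_Mapping.lookup \<alpha> i))) [0..<Poly_Mapping.degree \<alpha>] (v s)) (v t))"

end

theory Submission
  imports Defs "HOL-Combinatorics.Permutations"
begin

text \<open>
  The power sums \<open>p\<^sub>M\<close> form a basis of the symmetric functions, so the algebra of symmetric functions
  acts on \<open>V\<close> in two ways: \<open>p\<^sub>n\<close> by \<open>B\<^sub>n\<close> (action \<open>P\<close>) or by \<open>B\<^sub>-\<^sub>n\<close> (action \<open>N\<close>). Then \<open>D\<^sub>k = P h\<^sub>k\<close> and
  \<open>U\<^sub>k = N h\<^sub>k\<close>, and since the Hall product with \<open>\<Prod>\<^sub>i h\<^bsub>\<alpha> i\<^esub>\<close> extracts the coefficient of \<open>x\<^sup>\<alpha>\<close>, the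
  symmetric functions \<open>G\<^sub>s\<close> and \<open>F\<^sub>s\<close> represent functionals: \<open>\<langle>G\<^sub>s, f\<rangle> = \<langle>P f v\<^sub>s, v\<^sub>b\<rangle>\<close> and
  \<open>\<langle>F\<^sub>s, f\<rangle> = \<langle>N f v\<^sub>b, v\<^sub>s\<rangle>\<close>. Now the dual identities only say that \<open>P\<close> and \<open>N\<close> are multiplicative, and
  the other two follow because the adjoint \<open>n \<partial>/\<partial>p\<^sub>n\<close> of multiplication by \<open>p\<^sub>n\<close> is, up to the factor \<open>a\<^sub>n\<close>,
  the commutator with \<open>B\<^sub>-\<^sub>n\<close> (on \<open>P\<close>) or \<open>B\<^sub>n\<close> (on \<open>N\<close>), of which only one term survives: \<open>v\<^sub>b\<close> is orthogonal
  to the image of \<open>B\<^sub>-\<^sub>n\<close> (for \<open>G\<close>) and killed by \<open>B\<^sub>n\<close> (for \<open>F\<close>).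
\<close>

section \<open>The power sum basis\<close>

lemmas symfun_coeff_simps =
  zero_symfun.rep_eq one_symfun.rep_eq plus_symfun.rep_eq symfun_scale.rep_eq h_sym.rep_eq p_sym.rep_eq

lemma symfun_eqI: "(\<And>\<alpha>. symfun_coeff f \<alpha> = symfun_coeff g \<alpha>) \<Longrightarrow> f = g"
  by (simp add: symfun_coeff_inject[symmetric] fun_eq_iff)

lemma symfun_coeff_sum: "symfun_coeff (sum f A) \<alpha> = (\<Sum>x\<in>A. symfun_coeff (f x) \<alpha>)"
  by (induction A rule: infinite_finite_induct) (auto simp: symfun_coeff_simps)

lemma symfun_coeff_bounded: obtains d where "\<And>\<alpha>. symfun_coeff f \<alpha> \<noteq> 0 \<Longrightarrow> expo_deg \<alpha> \<le> d"
  using symfun_coeff[of f] by (auto simp: is_symfun_def)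

lemma symfun_coeff_map_key:
  "bij \<pi> \<Longrightarrow> symfun_coeff f (Poly_Mapping.map_key \<pi> \<alpha>) = symfun_coeff f \<alpha>"
  using symfun_coeff[of f] by (auto simp: is_symfun_def)

lemma symfun_scale_mult_left: "symfun_scale c f * g = symfun_scale c (f * g)"
  by (rule symfun_eqI)
     (simp add: symfun_scale.rep_eq times_symfun.rep_eq series_mult_def sum_distrib_left
       case_prod_unfold mult.assoc)

lemma symfun_scale_mult_right: "g * symfun_scale c f = symfun_scale c (g * f)"
  using symfun_scale_mult_left[of c f g] by (simp add: mult.commute)

lemma single_add_diff:
  fixes \<alpha> :: "nat \<Rightarrow>\<^sub>0 nat"
  assumes "n \<le> Poly_Mapping.lookup \<alpha> i"
  shows "Poly_Mapping.single i n + (\<alpha> - Poly_Mapping.single i n) = \<alpha>"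
  using assms by (intro poly_mapping_eqI) (auto simp: lookup_add lookup_minus lookup_single when_def)

lemma keys_single_add:
  fixes \<alpha> :: "nat \<Rightarrow>\<^sub>0 nat"
  assumes "n > 0"
  shows "Poly_Mapping.keys (Poly_Mapping.single i n + \<alpha>) = insert i (Poly_Mapping.keys \<alpha>)"
  using assms by (auto simp: in_keys_iff lookup_add lookup_single when_def split: if_splits)

text \<open>Only the splits with first part \<open>single i n\<close> meet the support of
  \<open>p_sym n\<close>. For \<open>n = 0\<close> they would not determine \<open>i\<close>, hence
  \<open>n > 0\<close>.\<close>

lemma symfun_coeff_p_times:
  assumes "n > 0"
  shows "symfun_coeff (p_sym n * f) \<alpha> =
    (\<Sum>i\<in>{i\<in>Poly_Mapping.keys \<alpha>. n \<le> Poly_Mapping.lookup \<alpha> i}. symfun_coeff f (\<alpha> - Poly_Mapping.single i n))"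
proof -
  let ?S = "{i\<in>Poly_Mapping.keys \<alpha>. n \<le> Poly_Mapping.lookup \<alpha> i}"
  let ?T = "(\<lambda>i. (Poly_Mapping.single i n, \<alpha> - Poly_Mapping.single i n)) ` ?S"
  have inj: "inj_on (\<lambda>i. (Poly_Mapping.single i n, \<alpha> - Poly_Mapping.single i n)) ?S"
  proof (rule inj_onI)
    fix i j assume "(Poly_Mapping.single i n, \<alpha> - Poly_Mapping.single i n) =
      (Poly_Mapping.single j n, \<alpha> - Poly_Mapping.single j n)"
    then have "Poly_Mapping.keys (Poly_Mapping.single i n) = Poly_Mapping.keys (Poly_Mapping.single j n)"
      by simp
    then show "i = j" using assms by simp
  qed
  have "symfun_coeff (p_sym n * f) \<alpha> =
    (\<Sum>(\<beta>, \<gamma>)\<in>expo_splits \<alpha>. (if \<exists>i. \<beta> = Poly_Mapping.single i n then 1 else 0) * symfun_coeff f \<gamma>)"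
    by (simp add: times_symfun.rep_eq series_mult_def p_sym.rep_eq)
  also have "\<dots> = (\<Sum>(\<beta>, \<gamma>)\<in>?T. symfun_coeff f \<gamma>)"
  proof (rule sum.mono_neutral_cong_right)
    show "?T \<subseteq> expo_splits \<alpha>" by (auto simp: expo_splits_def single_add_diff)
    have *: "(Poly_Mapping.single i n, \<gamma>) \<in> ?T" if "(Poly_Mapping.single i n, \<gamma>) \<in> expo_splits \<alpha>" for i \<gamma>
    proof -
      from that have a: "\<alpha> = Poly_Mapping.single i n + \<gamma>" by (simp add: expo_splits_def)
      have "i \<in> ?S" using assms by (simp add: a keys_single_add lookup_add)
      moreover have "\<gamma> = \<alpha> - Poly_Mapping.single i n" by (simp add: a)
      ultimately show ?thesis by blast
    qed
    show "\<forall>x\<in>expo_splits \<alpha> - ?T. (case x of (\<beta>, \<gamma>) \<Rightarrow>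
        (if \<exists>i. \<beta> = Poly_Mapping.single i n then 1 else 0) * symfun_coeff f \<gamma>) = 0"
    proof (clarify)
      fix \<beta> \<gamma> assume "(\<beta>, \<gamma>) \<in> expo_splits \<alpha>" "(\<beta>, \<gamma>) \<notin> ?T"
      with * have "\<nexists>i. \<beta> = Poly_Mapping.single i n" by blast
      then show "(if \<exists>i. \<beta> = Poly_Mapping.single i n then 1 else 0) * symfun_coeff f \<gamma> = 0" by simp
    qed
  qed (auto simp: finite_expo_splits)
  also have "\<dots> = (\<Sum>i\<in>?S. symfun_coeff f (\<alpha> - Poly_Mapping.single i n))"
    by (subst sum.reindex[OF inj]) simp
  finally show ?thesis .
qed

section \<open>Newton's identity for the complete homogeneous functions\<close>

lemma h_sym_0 [simp]: "h_sym 0 = 1"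
proof (rule symfun_eqI)
  fix \<alpha>
  have "expo_deg \<alpha> = 0 \<longleftrightarrow> \<alpha> = 0"
    unfolding expo_deg_def
    by (metis expo_deg_def expo_deg_zero finite_keys in_keys_iff keys_eq_empty sum_eq_0_iff all_not_in_conv)
  then show "symfun_coeff (h_sym 0) \<alpha> = symfun_coeff (1::'a symfun) \<alpha>"
    by (simp add: symfun_coeff_simps)
qed

text \<open>At a monomial of degree \<open>k\<close>, \<open>p_sym j * h_sym (k - j)\<close> counts
  the variables with exponent at least \<open>j\<close>. Over all \<open>j\<close>, a variable is
  counted as often as its exponent says, which adds up to \<open>k\<close>.\<close>

lemma h_sym_newton:
  "symfun_scale (of_nat k) (h_sym k) = (\<Sum>j=1..k. p_sym j * h_sym (k - j) :: 'k::field symfun)"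
proof (rule symfun_eqI)
  fix \<alpha> :: "nat \<Rightarrow>\<^sub>0 nat"
  let ?K = "Poly_Mapping.keys \<alpha>" and ?l = "Poly_Mapping.lookup \<alpha>"
  have eq: "symfun_coeff (p_sym j * h_sym (k - j) :: 'k symfun) \<alpha> =
      (if expo_deg \<alpha> = k then of_nat (card {i\<in>?K. j \<le> ?l i}) else 0)"
    if "j \<in> {1..k}" for j
  proof -
    have d: "expo_deg \<alpha> = j + expo_deg (\<alpha> - Poly_Mapping.single i j)" if "j \<le> ?l i" for i
      using single_add_diff[OF that] by (metis expo_deg_add expo_deg_single)
    have h: "symfun_coeff (h_sym (k - j) :: 'k symfun) (\<alpha> - Poly_Mapping.single i j) =
        (if expo_deg \<alpha> = k then 1 else 0)" if "j \<le> ?l i" for i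
      using d[OF that] \<open>j \<in> {1..k}\<close> by (auto simp: h_sym.rep_eq)
    have "symfun_coeff (p_sym j * h_sym (k - j) :: 'k symfun) \<alpha> =
        (\<Sum>i\<in>{i\<in>?K. j \<le> ?l i}. (if expo_deg \<alpha> = k then 1 else 0))"
      using that by (subst symfun_coeff_p_times) (auto simp only: h mem_Collect_eq atLeastAtMost_iff intro!: sum.cong)
    then show ?thesis by simp
  qed
  have "(\<Sum>j=1..k. card {i\<in>?K. j \<le> ?l i}) = k" if k: "expo_deg \<alpha> = k"
  proof -
    have le: "?l i \<le> k" if "i \<in> ?K" for i
      using that k member_le_sum[of i ?K ?l] by (auto simp: expo_deg_def)
    have "(\<Sum>j=1..k. card {i\<in>?K. j \<le> ?l i}) = (\<Sum>j=1..k. \<Sum>i\<in>?K. if j \<le> ?l i then 1 else 0)"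
      by (intro sum.cong refl) (simp add: sum.If_cases Int_def)
    also have "\<dots> = (\<Sum>i\<in>?K. \<Sum>j=1..k. if j \<le> ?l i then 1 else 0)"
      by (rule sum.swap)
    also have "\<dots> = (\<Sum>i\<in>?K. ?l i)"
    proof (intro sum.cong refl)
      fix i assume "i \<in> ?K"
      then have "{1..k} \<inter> {j. j \<le> ?l i} = {1..?l i}" using le[of i] by auto
      then show "(\<Sum>j=1..k. if j \<le> ?l i then 1 else 0) = ?l i" by (simp add: sum.If_cases)
    qed
    finally show ?thesis using k by (simp add: expo_deg_def)
  qed
  then show "symfun_coeff (symfun_scale (of_nat k) (h_sym k) :: 'k symfun) \<alpha> =
      symfun_coeff (\<Sum>j=1..k. p_sym j * h_sym (k - j)) \<alpha>"
    by (auto simp: symfun_coeff_sum eq symfun_coeff_simps simp flip: of_nat_sum)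
qed

section \<open>Products of power sums, indexed by multisets of parts\<close>

definition p_mset :: "nat multiset \<Rightarrow> 'a::comm_ring_1 symfun" where
  "p_mset M = prod_mset (image_mset p_sym M)"

lemma p_mset_empty [simp]: "p_mset {#} = 1"
  and p_mset_add [simp]: "p_mset (add_mset n M) = p_sym n * p_mset M"
  and p_mset_union: "p_mset (M + N) = p_mset M * p_mset N"
  by (simp_all add: p_mset_def)

text \<open>Multisets allow products to be built up one factor at a time, in any order; this is the
  bridge back to partitions as lists.\<close>

lemma p_part_mset: "p_part \<mu> = p_mset (mset \<mu>)"
  by (induction \<mu>) (auto simp: p_part_def)

text \<open>The type of a monomial: its exponents form a partition, which labels its orbit under
  permutations of the variables.\<close>

definition expo_parts :: "(nat \<Rightarrow>\<^sub>0 nat) \<Rightarrow> nat multiset" where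
  "expo_parts \<alpha> = image_mset (Poly_Mapping.lookup \<alpha>) (mset_set (Poly_Mapping.keys \<alpha>))"

lemma size_expo_parts [simp]: "size (expo_parts \<alpha>) = card (Poly_Mapping.keys \<alpha>)"
  by (simp add: expo_parts_def)

lemma zero_not_in_expo_parts [simp]: "0 \<notin># expo_parts \<alpha>"
  by (auto simp: expo_parts_def in_keys_iff)

lemma sum_expo_parts [simp]: "sum_mset (expo_parts \<alpha>) = expo_deg \<alpha>"
  by (simp add: expo_parts_def expo_deg_def sum_unfold_sum_mset)

lemma expo_parts_single_add:
  assumes "i \<notin> Poly_Mapping.keys \<alpha>" "n > 0"
  shows "expo_parts (Poly_Mapping.single i n + \<alpha>) = add_mset n (expo_parts \<alpha>)"
proof -
  have "image_mset (Poly_Mapping.lookup (Poly_Mapping.single i n + \<alpha>)) (mset_set (Poly_Mapping.keys \<alpha>))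
      = image_mset (Poly_Mapping.lookup \<alpha>) (mset_set (Poly_Mapping.keys \<alpha>))"
    using assms by (intro image_mset_cong) (auto simp: lookup_add lookup_single when_def)
  moreover have "Poly_Mapping.lookup (Poly_Mapping.single i n + \<alpha>) i = n"
    using assms by (simp add: lookup_add in_keys_iff)
  ultimately show ?thesis using assms by (simp add: expo_parts_def keys_single_add)
qed

lemma expo_parts_exists: "0 \<notin># M \<Longrightarrow> \<exists>\<alpha>. expo_parts \<alpha> = M"
proof (induction M)
  case empty
  then show ?case by (intro exI[of _ 0]) (simp add: expo_parts_def)
next
  case (add n M)
  then obtain \<alpha> where a: "expo_parts \<alpha> = M" by auto
  obtain i where "i \<notin> Poly_Mapping.keys \<alpha>"
    using ex_new_if_finite[of "Poly_Mapping.keys \<alpha>"] by auto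
  with a add.prems show ?case using expo_parts_single_add[of i \<alpha> n] by auto
qed

lemma symfun_coeff_expo_parts:
  assumes "expo_parts \<alpha> = expo_parts \<beta>"
  shows "symfun_coeff f \<alpha> = symfun_coeff f \<beta>"
proof -
  let ?A = "Poly_Mapping.keys \<alpha> \<union> Poly_Mapping.keys \<beta>"
  \<comment> \<open>Padding with zeros to the common finite set \<open>?A\<close> makes the two
    families of exponents equal as multisets, so a permutation inside \<open>?A\<close> carries one
    to the other.\<close>
  have *: "image_mset (Poly_Mapping.lookup \<gamma>) (mset_set ?A) =
      expo_parts \<gamma> + replicate_mset (card ?A - size (expo_parts \<gamma>)) 0"
    if "Poly_Mapping.keys \<gamma> \<subseteq> ?A" for \<gamma> :: "nat \<Rightarrow>\<^sub>0 nat"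
  proof -
    let ?K = "Poly_Mapping.keys \<gamma>"
    have "mset_set ?A = mset_set ?K + mset_set (?A - ?K)"
      using that by (subst mset_set_Union[symmetric]) (auto intro: arg_cong[of _ _ mset_set])
    moreover have "image_mset (Poly_Mapping.lookup \<gamma>) (mset_set (?A - ?K)) =
        image_mset (\<lambda>_. 0) (mset_set (?A - ?K))"
      by (intro image_mset_cong) (auto simp: in_keys_iff)
    moreover have "card (?A - ?K) = card ?A - card ?K"
      using that by (simp add: card_Diff_subset)
    ultimately show ?thesis by (simp add: expo_parts_def image_mset_const_eq)
  qed
  have "image_mset (Poly_Mapping.lookup \<alpha>) (mset_set ?A) = image_mset (Poly_Mapping.lookup \<beta>) (mset_set ?A)"
    using *[of \<alpha>] *[of \<beta>] assms by simp
  then obtain p where p: "p permutes ?A" "\<forall>x\<in>?A. Poly_Mapping.lookup \<alpha> x = Poly_Mapping.lookup \<beta> (p x)"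
    by (rule image_mset_eq_implies_permutes[rotated]) auto
  have b: "bij p" by (rule permutes_bij[OF p(1)])
  have "Poly_Mapping.lookup \<alpha> x = Poly_Mapping.lookup \<beta> (p x)" for x
  proof (cases "x \<in> ?A")
    case False
    then show ?thesis using p(1) by (auto simp: permutes_def in_keys_iff)
  qed (use p in auto)
  then have "\<alpha> = Poly_Mapping.map_key p \<beta>"
    using bij_is_inj[OF b] by (intro poly_mapping_eqI) (simp add: map_key.rep_eq)
  then show ?thesis using symfun_coeff_map_key[OF b] by simp
qed

text \<open>Expanding the product assigns each part of \<open>M\<close> to a variable, where parts
  add up. Fewer variables than parts means a collision; without collisions the exponents are exactly
  \<open>M\<close>.\<close>

lemma symfun_coeff_p_mset_nonzero:
  assumes "0 \<notin># M" "symfun_coeff (p_mset M) \<alpha> \<noteq> 0"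
  shows "card (Poly_Mapping.keys \<alpha>) \<le> size M \<and>
    (card (Poly_Mapping.keys \<alpha>) = size M \<longrightarrow> expo_parts \<alpha> = M) \<and> expo_deg \<alpha> = sum_mset M"
  using assms
proof (induction M arbitrary: \<alpha>)
  case empty
  then have "\<alpha> = 0" by (auto simp: one_symfun.rep_eq split: if_splits)
  then show ?case by (simp add: expo_parts_def)
next
  case (add n M)
  have n: "n > 0" using add.prems by auto
  obtain i where "i \<in> {i\<in>Poly_Mapping.keys \<alpha>. n \<le> Poly_Mapping.lookup \<alpha> i}"
    and nz: "symfun_coeff (p_mset M :: 'a symfun) (\<alpha> - Poly_Mapping.single i n) \<noteq> 0"
    using add.prems(2) unfolding p_mset_add symfun_coeff_p_times[OF n]
    by (rule sum.not_neutral_contains_not_neutral)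
  then have i: "n \<le> Poly_Mapping.lookup \<alpha> i" by simp
  define \<gamma> where "\<gamma> = \<alpha> - Poly_Mapping.single i n"
  have a: "\<alpha> = Poly_Mapping.single i n + \<gamma>" using single_add_diff[OF i] by (simp add: \<gamma>_def)
  have IH: "card (Poly_Mapping.keys \<gamma>) \<le> size M"
    "card (Poly_Mapping.keys \<gamma>) = size M \<Longrightarrow> expo_parts \<gamma> = M" "expo_deg \<gamma> = sum_mset M"
    using add.IH[of \<gamma>] add.prems(1) nz by (auto simp: \<gamma>_def)
  show ?case
  proof (cases "i \<in> Poly_Mapping.keys \<gamma>")
    case True
    then show ?thesis using IH n by (auto simp: a keys_single_add insert_absorb expo_deg_add)
  next
    case False
    then show ?thesis using IH n
      by (auto simp: a keys_single_add expo_parts_single_add expo_deg_add)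
  qed
qed

text \<open>The coefficient counts assignments of parts to variables. As the image of a natural
  number it can be shown positive although the field carries no order; characteristic 0 then makes
  it non-zero.\<close>

lemma symfun_coeff_p_mset_of_nat:
  assumes "0 \<notin># M"
  shows "\<exists>c. symfun_coeff (p_mset M) \<alpha> = of_nat c \<and> (expo_parts \<alpha> = M \<longrightarrow> c > 0)"
  using assms
proof (induction M arbitrary: \<alpha>)
  case empty
  have "expo_parts \<alpha> = {#} \<Longrightarrow> \<alpha> = 0" by (simp add: expo_parts_def mset_set_empty_iff)
  then show ?case
    by (intro exI[of _ "if \<alpha> = 0 then 1 else 0"]) (auto simp: one_symfun.rep_eq)
next
  case (add n M)
  have n: "n > 0" using add.prems by auto
  from add have "\<forall>\<alpha>. \<exists>c. symfun_coeff (p_mset M :: 'a symfun) \<alpha> = of_nat c \<and> (expo_parts \<alpha> = M \<longrightarrow> c > 0)"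
    by auto
  then obtain c where c: "\<And>\<alpha>. symfun_coeff (p_mset M :: 'a symfun) \<alpha> = of_nat (c \<alpha>)"
    "\<And>\<alpha>. expo_parts \<alpha> = M \<Longrightarrow> c \<alpha> > 0"
    by metis
  let ?S = "{i\<in>Poly_Mapping.keys \<alpha>. n \<le> Poly_Mapping.lookup \<alpha> i}"
  show ?case
  proof (intro exI conjI impI)
    show "symfun_coeff (p_mset (add_mset n M) :: 'a symfun) \<alpha> =
      of_nat (\<Sum>i\<in>?S. c (\<alpha> - Poly_Mapping.single i n))"
      by (simp add: symfun_coeff_p_times[OF n] c)
    assume e: "expo_parts \<alpha> = add_mset n M"
    then have "n \<in># expo_parts \<alpha>" by simp
    then obtain i where i: "i \<in> Poly_Mapping.keys \<alpha>" "n = Poly_Mapping.lookup \<alpha> i"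
      by (auto simp: expo_parts_def)
    define \<gamma> where "\<gamma> = \<alpha> - Poly_Mapping.single i n"
    have a: "\<alpha> = Poly_Mapping.single i n + \<gamma>"
      using single_add_diff[of n \<alpha> i] i by (simp add: \<gamma>_def)
    have "i \<notin> Poly_Mapping.keys \<gamma>" by (simp add: \<gamma>_def i in_keys_iff lookup_minus)
    then have "expo_parts \<gamma> = M" using e n by (simp add: a expo_parts_single_add)
    then have "c \<gamma> > 0" by (rule c)
    then show "(\<Sum>i\<in>?S. c (\<alpha> - Poly_Mapping.single i n)) > 0"
      using i by (intro sum_pos2[of _ i]) (auto simp: \<gamma>_def)
  qed
qed

lemma symfun_coeff_p_mset_diag:
  assumes "0 \<notin># M" "expo_parts \<alpha> = M"
  shows "symfun_coeff (p_mset M :: 'k::field_char_0 symfun) \<alpha> \<noteq> 0"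
  using symfun_coeff_p_mset_of_nat[OF assms(1), where 'a = 'k and \<alpha> = \<alpha>] assms(2) by auto

section \<open>Linear independence and spanning\<close>

lemma finite_msets_sum_le: "finite {M :: nat multiset. 0 \<notin># M \<and> sum_mset M \<le> d}"
proof (rule finite_subset)
  show "finite (mset ` {xs. set xs \<subseteq> {..d} \<and> length xs \<le> d})"
    by (intro finite_imageI finite_lists_length_le) auto
  show "{M :: nat multiset. 0 \<notin># M \<and> sum_mset M \<le> d} \<subseteq> mset ` {xs. set xs \<subseteq> {..d} \<and> length xs \<le> d}"
  proof
    fix M :: "nat multiset" assume M: "M \<in> {M. 0 \<notin># M \<and> sum_mset M \<le> d}"
    obtain xs where xs: "M = mset xs" by (metis ex_mset)
    have s: "sum_list xs \<le> d" and nz: "0 \<notin> set xs" using M xs by (auto simp: sum_mset_sum_list)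
    have "x \<le> d" if "x \<in> set xs" for x using member_le_sum_list[OF that] s by simp
    moreover have "length xs \<le> sum_list xs" using nz by (induction xs) auto
    ultimately show "M \<in> mset ` {xs. set xs \<subseteq> {..d} \<and> length xs \<le> d}"
      using xs s by auto
  qed
qed

text \<open>
  Triangularity: \<open>p_mset M\<close> involves only monomials with at most \<open>size M\<close> variables, and among
  those with exactly \<open>size M\<close> variables only the ones whose exponents form \<open>M\<close>.
\<close>

lemma p_mset_sum_eq_0D:
  fixes c :: "nat multiset \<Rightarrow> 'k::field_char_0"
  assumes "finite S" "\<And>M. M \<in> S \<Longrightarrow> 0 \<notin># M"
    and "(\<Sum>M\<in>S. symfun_scale (c M) (p_mset M)) = 0" "M \<in> S"
  shows "c M = 0"
proof (rule ccontr)
  assume "c M \<noteq> 0"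
  define T where "T = {M\<in>S. c M \<noteq> 0}"
  have T: "finite T" "T \<noteq> {}" using assms \<open>c M \<noteq> 0\<close> by (auto simp: T_def)
  \<comment> \<open>Maximal size isolates \<open>N\<close>: a monomial of type \<open>N\<close>
    occurs in \<open>p_mset M\<close> only if \<open>size M \<ge> size N\<close>, and for equal
    sizes only if \<open>M = N\<close>.\<close>
  obtain N where N: "N \<in> T" "size N = Max (size ` T)"
    using Max_in[of "size ` T"] T by (metis finite_imageI image_iff image_is_empty)
  then have N: "N \<in> T" "\<And>M. M \<in> T \<Longrightarrow> size M \<le> size N" using T by auto
  then have NS: "N \<in> S" "c N \<noteq> 0" "0 \<notin># N" using assms by (auto simp: T_def)
  obtain \<alpha> where \<alpha>: "expo_parts \<alpha> = N" using expo_parts_exists[OF NS(3)] by auto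
  have "c M * symfun_coeff (p_mset M) \<alpha> = 0" if "M \<in> S" "M \<noteq> N" for M
  proof (rule ccontr)
    assume nz: "c M * symfun_coeff (p_mset M) \<alpha> \<noteq> 0"
    then have "size M \<le> size N" using that N by (auto simp: T_def)
    with symfun_coeff_p_mset_nonzero[of M \<alpha>] nz that assms(2) \<alpha>
    show False by (metis le_antisym mult_zero_right size_expo_parts)
  qed
  then have "(\<Sum>M\<in>S - {N}. c M * symfun_coeff (p_mset M) \<alpha>) = 0"
    by (intro sum.neutral) blast
  then have "(\<Sum>M\<in>S. c M * symfun_coeff (p_mset M) \<alpha>) = c N * symfun_coeff (p_mset N) \<alpha>"
    using assms(1) NS(1) by (simp add: sum.remove[of S N])
  moreover have "(\<Sum>M\<in>S. c M * symfun_coeff (p_mset M) \<alpha>) = 0"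
    using arg_cong[OF assms(3), of "\<lambda>f. symfun_coeff f \<alpha>"]
    by (simp add: symfun_coeff_sum symfun_scale.rep_eq zero_symfun.rep_eq)
  ultimately show False using NS symfun_coeff_p_mset_diag[OF NS(3) \<alpha>] by auto
qed

lemma inj_on_p_mset: "inj_on (p_mset :: _ \<Rightarrow> 'k::field_char_0 symfun) {M. 0 \<notin># M}"
proof (rule inj_onI, rule ccontr)
  fix M N assume "M \<in> {M. 0 \<notin># M}" "N \<in> {M. 0 \<notin># M}" "p_mset M = (p_mset N :: 'k symfun)" "M \<noteq> N"
  then show False
    using p_mset_sum_eq_0D[of "{M, N}" "\<lambda>K. if K = M then 1 else -1 :: 'k" M] by auto
qed

lemma p_mset_independent: "symfun.independent (p_mset ` {M. 0 \<notin># M} :: 'k::field_char_0 symfun set)"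
  unfolding symfun.independent_explicit_module
proof (intro allI impI)
  fix t and u :: "'k symfun \<Rightarrow> 'k" and x
  assume t: "finite t" "t \<subseteq> p_mset ` {M. 0 \<notin># M}" "(\<Sum>v\<in>t. symfun_scale (u v) v) = 0" "x \<in> t"
  from t(1,2) obtain S where S: "S \<subseteq> {M. 0 \<notin># M}" "finite S" "t = p_mset ` S"
    by (metis finite_subset_image)
  have inj: "inj_on (p_mset :: _ \<Rightarrow> 'k symfun) S" using inj_on_p_mset S(1) inj_on_subset by blast
  from t(4) S obtain M where M: "M \<in> S" "x = p_mset M" by auto
  have "(\<Sum>M\<in>S. symfun_scale (u (p_mset M)) (p_mset M)) = 0"
    using t(3) by (simp add: S(3) sum.reindex[OF inj])
  from p_mset_sum_eq_0D[OF S(2) _ this M(1)] S(1) M(2) show "u x = 0" by auto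
qed

text \<open>Induction on the number of variables: a combination \<open>g\<close> of the
  \<open>p_mset M\<close> with \<open>size M = L\<close> matches \<open>f\<close> on the monomials
  in exactly \<open>L\<close> variables, so \<open>f - g\<close> involves fewer. The degree bound
  makes this combination finite.\<close>

lemma p_mset_span_bounded:
  fixes f :: "'k::field_char_0 symfun"
  assumes "\<And>\<alpha>. symfun_coeff f \<alpha> \<noteq> 0 \<Longrightarrow> card (Poly_Mapping.keys \<alpha>) < L"
    and "\<And>\<alpha>. symfun_coeff f \<alpha> \<noteq> 0 \<Longrightarrow> expo_deg \<alpha> \<le> d"
  shows "f \<in> symfun.span (p_mset ` {M. 0 \<notin># M})"
  using assms
proof (induction L arbitrary: f)
  case 0
  then have "f = 0" by (intro symfun_eqI) (auto simp: zero_symfun.rep_eq)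
  then show ?case by (simp add: symfun.span_zero)
next
  case (Suc L)
  define S where "S = {M :: nat multiset. 0 \<notin># M \<and> sum_mset M \<le> d \<and> size M = L}"
  have fin: "finite S" by (rule finite_subset[OF _ finite_msets_sum_le[of d]]) (auto simp: S_def)
  \<comment> \<open>Any monomial of type \<open>M\<close> serves as representative, since
    coefficients depend only on the type.\<close>
  define e where "e M = (SOME \<alpha>. expo_parts \<alpha> = M)" for M
  have e: "expo_parts (e M) = M" if "M \<in> S" for M
    unfolding e_def by (rule someI_ex) (use that in \<open>simp add: S_def expo_parts_exists\<close>)
  define g where "g = (\<Sum>M\<in>S. symfun_scale
    (symfun_coeff f (e M) / symfun_coeff (p_mset M) (e M)) (p_mset M :: 'k symfun))"
  have gspan: "g \<in> symfun.span (p_mset ` {M. 0 \<notin># M})"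
    unfolding g_def by (intro symfun.span_sum symfun.span_scale symfun.span_base) (auto simp: S_def)
  have g: "symfun_coeff g \<alpha> = (\<Sum>M\<in>S. symfun_coeff f (e M) / symfun_coeff (p_mset M) (e M)
      * symfun_coeff (p_mset M :: 'k symfun) \<alpha>)" for \<alpha>
    by (simp add: g_def symfun_coeff_sum symfun_scale.rep_eq)
  have gnz: "card (Poly_Mapping.keys \<alpha>) \<le> L \<and> expo_deg \<alpha> \<le> d" if nz: "symfun_coeff g \<alpha> \<noteq> 0" for \<alpha>
  proof -
    obtain M where "M \<in> S" "symfun_coeff f (e M) / symfun_coeff (p_mset M) (e M)
        * symfun_coeff (p_mset M :: 'k symfun) \<alpha> \<noteq> 0"
      using nz unfolding g by (rule sum.not_neutral_contains_not_neutral)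
    then have "M \<in> S" "symfun_coeff (p_mset M :: 'k symfun) \<alpha> \<noteq> 0" by auto
    then show ?thesis using symfun_coeff_p_mset_nonzero[of M \<alpha>, where 'a = 'k] by (auto simp: S_def)
  qed
  have diag: "symfun_coeff g \<alpha> = symfun_coeff f \<alpha>" if "card (Poly_Mapping.keys \<alpha>) = L" for \<alpha>
  proof -
    let ?N = "expo_parts \<alpha>"
    have other: "symfun_coeff (p_mset M :: 'k symfun) \<alpha> = 0" if "M \<in> S" "M \<noteq> ?N" for M
      using that symfun_coeff_p_mset_nonzero[of M \<alpha>, where 'a = 'k] \<open>card _ = L\<close> by (auto simp: S_def)
    show ?thesis
    proof (cases "?N \<in> S")
      case True
      have "symfun_coeff g \<alpha> = symfun_coeff f (e ?N) / symfun_coeff (p_mset ?N) (e ?N)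
          * symfun_coeff (p_mset ?N :: 'k symfun) \<alpha>"
        unfolding g using fin True other by (subst sum.remove[of _ ?N]) auto
      moreover have "symfun_coeff h (e ?N) = symfun_coeff h \<alpha>" for h :: "'k symfun"
        by (rule symfun_coeff_expo_parts) (rule e[OF True])
      moreover have "symfun_coeff (p_mset ?N :: 'k symfun) \<alpha> \<noteq> 0"
        by (rule symfun_coeff_p_mset_diag) auto
      ultimately show ?thesis by simp
    next
      case False
      then have "symfun_coeff f \<alpha> = 0" using Suc.prems(2)[of \<alpha>] that by (auto simp: S_def)
      moreover have "symfun_coeff g \<alpha> = 0"
        unfolding g by (rule sum.neutral) (use False other in auto)
      ultimately show ?thesis by simp
    qed
  qed
  have minus: "symfun_coeff (f - g) \<alpha> = symfun_coeff f \<alpha> - symfun_coeff g \<alpha>" for \<alpha>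
    unfolding minus_symfun_def plus_symfun.rep_eq uminus_symfun.rep_eq by simp
  have "f - g \<in> symfun.span (p_mset ` {M. 0 \<notin># M})"
  proof (rule Suc.IH)
    fix \<alpha> assume a: "symfun_coeff (f - g) \<alpha> \<noteq> 0"
    then have or: "symfun_coeff f \<alpha> \<noteq> 0 \<or> symfun_coeff g \<alpha> \<noteq> 0" by (auto simp: minus)
    then show "expo_deg \<alpha> \<le> d" using Suc.prems(2) gnz by blast
    have "card (Poly_Mapping.keys \<alpha>) \<noteq> L" using a diag by (auto simp: minus)
    moreover have "card (Poly_Mapping.keys \<alpha>) \<le> L" using or Suc.prems(1)[of \<alpha>] gnz[of \<alpha>] by auto
    ultimately show "card (Poly_Mapping.keys \<alpha>) < L" by simp
  qed
  from symfun.span_add[OF this gspan] show ?case by simp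
qed

lemma p_mset_span: "symfun.span (p_mset ` {M. 0 \<notin># M}) = (UNIV :: 'k::field_char_0 symfun set)"
proof (rule UNIV_eq_I[symmetric])
  fix f :: "'k symfun"
  obtain d where d: "\<And>\<alpha>. symfun_coeff f \<alpha> \<noteq> 0 \<Longrightarrow> expo_deg \<alpha> \<le> d"
    using symfun_coeff_bounded[of f] by auto
  \<comment> \<open>A monomial has at most as many variables as its degree, so the degree bound of
    \<open>f\<close> also bounds the number of variables.\<close>
  have "card (Poly_Mapping.keys \<alpha>) \<le> expo_deg \<alpha>" for \<alpha>
    unfolding expo_deg_def using sum_mono[of "Poly_Mapping.keys \<alpha>" "\<lambda>_. 1" "Poly_Mapping.lookup \<alpha>"]
    by (auto simp: in_keys_iff Suc_le_eq)
  then have "card (Poly_Mapping.keys \<alpha>) < Suc d" if "symfun_coeff f \<alpha> \<noteq> 0" for \<alpha>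
    using d[OF that] by (metis le_imp_less_Suc le_trans)
  then show "f \<in> symfun.span (p_mset ` {M. 0 \<notin># M})" using d by (rule p_mset_span_bounded)
qed

lemma symfun_p_induct [case_names p_mset add scale]:
  fixes f :: "'k::field_char_0 symfun"
  assumes "\<And>M. 0 \<notin># M \<Longrightarrow> Q (p_mset M)"
    and "\<And>f g. Q f \<Longrightarrow> Q g \<Longrightarrow> Q (f + g)"
    and "\<And>c f. Q f \<Longrightarrow> Q (symfun_scale c f)"
  shows "Q f"
proof -
  have "f \<in> symfun.span (p_mset ` {M. 0 \<notin># M})" by (simp add: p_mset_span)
  then show ?thesis
  proof (induction rule: symfun.span_induct_alt)
    case base
    show ?case using assms(3)[OF assms(1)[of "{#}"], of 0] by simp
  next
    case (step c x y)
    then show ?case using assms by auto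
  qed
qed

text \<open>Values on a basis may be prescribed freely. Prescribing them by \<open>M\<close> rather
  than by \<open>p_mset M\<close> relies on injectivity of \<open>p_mset\<close>.\<close>

lemma symfun_linear_extend:
  fixes s :: "'k::field_char_0 \<Rightarrow> 'w::ab_group_add \<Rightarrow> 'w"
  assumes "vector_space s"
  shows "\<exists>T. Vector_Spaces.linear symfun_scale s T \<and> (\<forall>M. 0 \<notin># M \<longrightarrow> T (p_mset M) = g M)"
proof -
  interpret w: vector_space s by fact
  interpret vector_space_pair symfun_scale s ..
  obtain T where "Vector_Spaces.linear symfun_scale s T"
    "\<forall>x\<in>p_mset ` {M. 0 \<notin># M}. T x = g (the_inv_into {M. 0 \<notin># M} p_mset x)"
    using linear_independent_extend[OF p_mset_independent,
      of "\<lambda>x. g (the_inv_into {M. 0 \<notin># M} p_mset x)"] by blast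
  then show ?thesis
    by (intro exI[of _ T]) (auto simp: the_inv_into_f_f[OF inj_on_p_mset])
qed

section \<open>Power sum expansions\<close>

definition z_mset :: "nat multiset \<Rightarrow> nat" where
  "z_mset M = (\<Prod>i\<in>set_mset M. i ^ count M i * fact (count M i))"

lemma z_mset_superset:
  assumes "finite A" "set_mset M \<subseteq> A"
  shows "z_mset M = (\<Prod>i\<in>A. i ^ count M i * fact (count M i))"
  unfolding z_mset_def using assms
  by (intro prod.mono_neutral_left) (auto simp: not_in_iff)

lemma z_mset_empty [simp]: "z_mset {#} = 1"
  by (simp add: z_mset_def)

lemma z_mset_add: "z_mset (add_mset n M) = n * Suc (count M n) * z_mset M"
proof -
  let ?A = "insert n (set_mset M)"
  have "z_mset (add_mset n M) = (\<Prod>i\<in>?A. i ^ count (add_mset n M) i * fact (count (add_mset n M) i))"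
    by (rule z_mset_superset) auto
  also have "\<dots> = n ^ Suc (count M n) * fact (Suc (count M n)) *
      (\<Prod>i\<in>?A - {n}. i ^ count M i * fact (count M i))"
    by (subst prod.remove[of _ n]) (auto intro!: prod.cong)
  also have "\<dots> = n * Suc (count M n) * (\<Prod>i\<in>?A. i ^ count M i * fact (count M i))"
    by (subst (2) prod.remove[of _ n]) (auto simp: algebra_simps)
  also have "(\<Prod>i\<in>?A. i ^ count M i * fact (count M i)) = z_mset M"
    by (rule z_mset_superset[symmetric]) auto
  finally show ?thesis .
qed

lemma z_mset_pos: "0 \<notin># M \<Longrightarrow> z_mset M > 0"
  by (induction M) (auto simp: z_mset_add)

lemma z_part_mset: "z_part \<mu> = z_mset (mset \<mu>)"
  by (simp add: z_part_def z_mset_def count_mset)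

definition mset_partitions :: "nat \<Rightarrow> nat multiset set" where
  "mset_partitions k = {M. 0 \<notin># M \<and> sum_mset M = k}"

lemma finite_mset_partitions [simp]: "finite (mset_partitions k)"
  by (rule finite_subset[OF _ finite_msets_sum_le[of k]]) (auto simp: mset_partitions_def)

lemma mset_partitions_0 [simp]: "mset_partitions 0 = {{#}}"
  by (auto simp: mset_partitions_def) (metis multiset_nonemptyE)

lemma is_partition_0_notin: "is_partition \<mu> \<Longrightarrow> 0 \<notin> set \<mu>"
  by (simp add: is_partition_def)

lemma is_partition_mset_inj:
  assumes "is_partition \<mu>" "is_partition \<nu>"
  shows "mset \<mu> = mset \<nu> \<longleftrightarrow> \<mu> = \<nu>"
proof
  assume m: "mset \<mu> = mset \<nu>"
  have "sorted (rev \<mu>)" "sorted (rev \<nu>)"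
    using assms by (auto simp: is_partition_def sorted_wrt_rev)
  with m have "rev \<mu> = rev \<nu>" by (metis mset_rev properties_for_sort)
  then show "\<mu> = \<nu>" by simp
qed simp

lemma is_partition_of_mset:
  assumes "0 \<notin># M" obtains \<mu> where "is_partition \<mu>" "mset \<mu> = M"
proof
  show "is_partition (rev (sorted_list_of_multiset M))"
    using assms by (auto simp: is_partition_def sorted_wrt_rev)
  show "mset (rev (sorted_list_of_multiset M)) = M" by simp
qed

lemma bij_betw_partitions_of: "bij_betw mset (partitions_of k) (mset_partitions k)"
  unfolding bij_betw_def
proof
  show "inj_on mset (partitions_of k)"
    using is_partition_mset_inj by (auto simp: inj_on_def partitions_of_def)
  show "mset ` partitions_of k = mset_partitions k"
  proof
    show "mset ` partitions_of k \<subseteq> mset_partitions k"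
      by (auto simp: partitions_of_def mset_partitions_def is_partition_def sum_mset_sum_list)
    show "mset_partitions k \<subseteq> mset ` partitions_of k"
    proof
      fix M assume M: "M \<in> mset_partitions k"
      then obtain \<mu> where \<mu>: "is_partition \<mu>" "mset \<mu> = M"
        by (auto simp: mset_partitions_def elim: is_partition_of_mset)
      then have "\<mu> \<in> partitions_of k"
        using M by (auto simp: partitions_of_def mset_partitions_def sum_mset_sum_list[symmetric])
      with \<mu> show "M \<in> mset ` partitions_of k" by blast
    qed
  qed
qed

lemma sum_mset_partitions_remove:
  fixes g :: "nat multiset \<Rightarrow> 'b::comm_monoid_add"
  assumes "n > 0"
  shows "(\<Sum>M\<in>{M\<in>mset_partitions k. n \<in># M}. g (M - {#n#})) =
    (if n \<le> k then \<Sum>M\<in>mset_partitions (k - n). g M else 0)"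
proof (cases "n \<le> k")
  case True
  have "(\<Sum>M\<in>{M\<in>mset_partitions k. n \<in># M}. g (M - {#n#})) = (\<Sum>M\<in>mset_partitions (k - n). g M)"
    by (rule sum.reindex_bij_witness[where i = "add_mset n" and j = "\<lambda>M. M - {#n#}"])
       (use assms True in \<open>auto simp: mset_partitions_def dest!: multi_member_split\<close>)
  with True show ?thesis by simp
next
  case False
  then have "{M\<in>mset_partitions k. n \<in># M} = {}"
    by (auto simp: mset_partitions_def dest!: multi_member_split)
  then show ?thesis using False by (simp only: sum.empty if_False)
qed

text \<open>Removing a part \<open>n\<close> divides \<open>z\<close> by
  \<open>n * count M n\<close>. This cancellation drives both the recursion for \<open>h_sym\<close>
  and the formula for its derivative.\<close>

lemma inverse_z_mset_remove:
  assumes "n \<in># M" "n > 0"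
  shows "inverse (of_nat (z_mset M)) * of_nat (n * count M n) =
    (inverse (of_nat (z_mset (M - {#n#}))) :: 'k::field_char_0)"
proof -
  from assms(1) obtain N where M: "M = add_mset n N" by (auto dest: multi_member_split)
  define c where "c = n * Suc (count N n)"
  have "c \<noteq> 0" using assms(2) by (simp add: c_def)
  moreover have "z_mset M = c * z_mset N" "n * count M n = c" "M - {#n#} = N"
    by (simp_all add: M z_mset_add c_def)
  ultimately show ?thesis by simp
qed

lemma symfun_scale_p_mset_remove:
  assumes "n \<in># M" "n > 0"
  shows "symfun_scale (inverse (of_nat (z_mset M))) (symfun_scale (of_nat (n * count M n)) f) =
    symfun_scale (inverse (of_nat (z_mset (M - {#n#})))) (f :: 'k::field_char_0 symfun)"
  using inverse_z_mset_remove[OF assms, where 'k = 'k] by simp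

lemma sum_mset_eq_sum_count: "sum_mset (M :: nat multiset) = (\<Sum>n\<in>set_mset M. n * count M n)"
proof -
  \<comment> \<open>The index set \<open>A\<close> is fixed in advance because
    \<open>set_mset M\<close> changes during the induction.\<close>
  have "sum_mset M = (\<Sum>n\<in>A. n * count M n)" if "finite A" "set_mset M \<subseteq> A" for A
    using that(2)
  proof (induction M)
    case (add x M)
    have "n * count (add_mset x M) n = n * count M n + (if n = x then x else 0)" for n by simp
    then show ?case using add that(1) by (simp only: sum.distrib) simp
  qed simp
  then show ?thesis by simp
qed

text \<open>The expansion satisfies Newton's recursion: write \<open>k\<close> as the sum of the
  \<open>n * count M n\<close>, cancel against \<open>z_mset M\<close>, exchange the sums and split
  off \<open>p_sym n\<close>. Characteristic 0 allows the final division by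
  \<open>k\<close>.\<close>

lemma h_sym_p_mset:
  "h_sym k = (\<Sum>M\<in>mset_partitions k. symfun_scale (inverse (of_nat (z_mset M)))
     (p_mset M :: 'k::field_char_0 symfun))"
proof (induction k rule: less_induct)
  case (less k)
  let ?S = "\<lambda>k. \<Sum>M\<in>mset_partitions k. symfun_scale (inverse (of_nat (z_mset M))) (p_mset M :: 'k symfun)"
  show ?case
  proof (cases "k = 0")
    case False
    have "symfun_scale (of_nat k) (?S k) =
        (\<Sum>M\<in>mset_partitions k. \<Sum>n\<in>{n\<in>{1..k}. n \<in># M}.
          symfun_scale (inverse (of_nat (z_mset (M - {#n#})))) (p_mset M))"
      unfolding symfun.scale_sum_right
    proof (intro sum.cong refl)
      fix M assume M: "M \<in> mset_partitions k"
      have set: "{n\<in>{1..k}. n \<in># M} = set_mset M"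
        using M by (auto simp: mset_partitions_def Suc_le_eq dest: multi_member_split intro!: Nat.gr0I)
      have "symfun_scale (of_nat k) (symfun_scale (inverse (of_nat (z_mset M))) (p_mset M :: 'k symfun)) =
          (\<Sum>n\<in>set_mset M. symfun_scale (inverse (of_nat (z_mset M)))
            (symfun_scale (of_nat (n * count M n)) (p_mset M)))"
        using M unfolding mset_partitions_def sum_mset_eq_sum_count
        by (auto simp add: symfun.scale_sum_left[symmetric] sum_distrib_left[symmetric] mult.commute)
      also have "\<dots> = (\<Sum>n\<in>set_mset M. symfun_scale (inverse (of_nat (z_mset (M - {#n#})))) (p_mset M))"
        by (intro sum.cong refl symfun_scale_p_mset_remove)
           (use M in \<open>auto simp: mset_partitions_def intro: Nat.gr0I\<close>)
      finally show "symfun_scale (of_nat k) (symfun_scale (inverse (of_nat (z_mset M))) (p_mset M :: 'k symfun)) =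
          (\<Sum>n\<in>{n\<in>{1..k}. n \<in># M}. symfun_scale (inverse (of_nat (z_mset (M - {#n#})))) (p_mset M))"
        by (simp only: set)
    qed
    also have "\<dots> = (\<Sum>n=1..k. \<Sum>M\<in>{M\<in>mset_partitions k. n \<in># M}.
        symfun_scale (inverse (of_nat (z_mset (M - {#n#})))) (p_mset M))"
      by (rule sum.swap_restrict) auto
    also have "\<dots> = (\<Sum>n=1..k. \<Sum>M\<in>{M\<in>mset_partitions k. n \<in># M}.
        p_sym n * symfun_scale (inverse (of_nat (z_mset (M - {#n#})))) (p_mset (M - {#n#})))"
      by (intro sum.cong refl) (auto simp: symfun_scale_mult_right dest!: multi_member_split)
    also have "\<dots> = (\<Sum>n=1..k. p_sym n * ?S (k - n))"
      by (intro sum.cong refl, subst sum_mset_partitions_remove) (auto simp: sum_distrib_left)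
    also have "\<dots> = (\<Sum>n=1..k. p_sym n * h_sym (k - n))"
      using less False by (intro sum.cong refl) auto
    also have "\<dots> = symfun_scale (of_nat k) (h_sym k)" by (rule h_sym_newton[symmetric])
    finally show ?thesis using False by simp
  qed simp
qed

section \<open>The Hall inner product\<close>

text \<open>The operator \<open>n * d/dp_n\<close> on polynomials in the power sums, prescribed on
  the basis. It will be the Hall adjoint of multiplication by \<open>p_sym n\<close>.\<close>

definition p_deriv :: "nat \<Rightarrow> 'k::field_char_0 symfun \<Rightarrow> 'k symfun" where
  "p_deriv n = (SOME T. Vector_Spaces.linear symfun_scale symfun_scale T \<and>
     (\<forall>M. 0 \<notin># M \<longrightarrow> T (p_mset M) = symfun_scale (of_nat (n * count M n)) (p_mset (M - {#n#}))))"

lemma p_deriv_spec: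
  "Vector_Spaces.linear symfun_scale symfun_scale (p_deriv n :: 'k::field_char_0 symfun \<Rightarrow> _) \<and>
     (\<forall>M. 0 \<notin># M \<longrightarrow> p_deriv n (p_mset M :: 'k symfun) =
       symfun_scale (of_nat (n * count M n)) (p_mset (M - {#n#})))"
  unfolding p_deriv_def by (rule someI_ex[OF symfun_linear_extend[OF symfun.vector_space_axioms]])

lemma linear_p_deriv: "Vector_Spaces.linear symfun_scale symfun_scale (p_deriv n)"
  and p_deriv_p_mset: "0 \<notin># M \<Longrightarrow>
    p_deriv n (p_mset M) = symfun_scale (of_nat (n * count M n)) (p_mset (M - {#n#}))"
  using p_deriv_spec by auto

lemma p_deriv_add: "p_deriv n (f + g) = p_deriv n f + p_deriv n g"
  and p_deriv_scale: "p_deriv n (symfun_scale c f) = symfun_scale c (p_deriv n f)"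
  using linear_p_deriv[of n, where 'a = 'a] by (auto simp: Vector_Spaces.linear_iff)

lemma p_deriv_sum: "p_deriv n (sum f A) = (\<Sum>x\<in>A. p_deriv n (f x))"
  using p_deriv_scale[of n 0 0] by (induction A rule: infinite_finite_induct) (auto simp: p_deriv_add)

lemma p_deriv_one [simp]: "p_deriv n 1 = 0"
  using p_deriv_p_mset[of "{#}" n] by simp

lemma p_deriv_mult_p_mset:
  assumes "0 \<notin># M" "0 \<notin># N"
  shows "p_deriv n (p_mset M * p_mset N) = p_deriv n (p_mset M) * p_mset N + p_mset M * p_deriv n (p_mset N)"
proof -
  \<comment> \<open>Multiplicities add, which splits the derivative into the two terms of Leibniz's
    rule. If \<open>n\<close> is not in \<open>M\<close>, the multisets on the two sides may differ,
    but the scalar is 0.\<close>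
  have 1: "symfun_scale (of_nat (n * count M n)) (p_mset (M + N - {#n#})) =
      symfun_scale (of_nat (n * count M n)) (p_mset (M - {#n#})) * (p_mset N :: 'a symfun)" for M N
  proof (cases "n \<in># M")
    case True
    then show ?thesis by (auto simp: p_mset_union symfun_scale_mult_left dest!: multi_member_split)
  qed (simp add: not_in_iff)
  have "p_deriv n (p_mset M * p_mset N :: 'a symfun) =
      symfun_scale (of_nat (n * count M n)) (p_mset (M + N - {#n#})) +
      symfun_scale (of_nat (n * count N n)) (p_mset (N + M - {#n#}))"
    using assms unfolding p_mset_union[symmetric]
    by (subst p_deriv_p_mset) (auto simp: algebra_simps symfun.scale_left_distrib)
  then show ?thesis using assms 1[of M N] 1[of N M] by (simp add: p_deriv_p_mset mult.commute)
qed

lemma p_deriv_mult: "p_deriv n (f * g) = p_deriv n f * g + f * p_deriv n g"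
proof (induction f rule: symfun_p_induct)
  case (p_mset M)
  show ?case
  proof (induction g rule: symfun_p_induct)
    case (p_mset N)
    then show ?case using \<open>0 \<notin># M\<close> by (rule p_deriv_mult_p_mset[rotated])
  qed (simp_all add: p_deriv_add p_deriv_scale algebra_simps symfun_scale_mult_left symfun_scale_mult_right
      symfun.scale_right_distrib)
qed (simp_all add: p_deriv_add p_deriv_scale algebra_simps symfun_scale_mult_left symfun_scale_mult_right
    symfun.scale_right_distrib)

lemma p_deriv_prod:
  "finite A \<Longrightarrow> p_deriv n (prod f A) = (\<Sum>x\<in>A. p_deriv n (f x) * prod f (A - {x}))"
proof (induction A rule: finite_induct)
  case (insert x A)
  have "prod f (insert x A - {y}) = f x * prod f (A - {y})" if "y \<in> A" for y
  proof -
    have "insert x A - {y} = insert x (A - {y})" using that insert.hyps by auto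
    then show ?thesis using insert.hyps by simp
  qed
  then have "(\<Sum>y\<in>A. p_deriv n (f y) * prod f (insert x A - {y})) = f x * p_deriv n (prod f A)"
    by (simp add: insert.IH sum_distrib_left algebra_simps)
  with insert.hyps show ?case by (simp add: p_deriv_mult)
qed simp

text \<open>In the power sum expansion the factor \<open>n * count M n\<close> cancels against
  \<open>z_mset M\<close>, which leaves the expansion of \<open>h_sym (k - n)\<close>.\<close>

lemma p_deriv_h_sym:
  assumes "n > 0"
  shows "p_deriv n (h_sym k) = (if n \<le> k then h_sym (k - n) else (0 :: 'k::field_char_0 symfun))"
proof -
  have "p_deriv n (h_sym k) = (\<Sum>M\<in>mset_partitions k. symfun_scale (inverse (of_nat (z_mset M)))
      (symfun_scale (of_nat (n * count M n)) (p_mset (M - {#n#}) :: 'k symfun)))"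
    unfolding h_sym_p_mset p_deriv_sum p_deriv_scale
    by (intro sum.cong refl, subst p_deriv_p_mset) (auto simp: mset_partitions_def)
  also have "\<dots> = (\<Sum>M\<in>{M\<in>mset_partitions k. n \<in># M}. symfun_scale (inverse (of_nat (z_mset M)))
      (symfun_scale (of_nat (n * count M n)) (p_mset (M - {#n#}) :: 'k symfun)))"
    by (rule sum.mono_neutral_right) (auto simp: not_in_iff)
  also have "\<dots> = (\<Sum>M\<in>{M\<in>mset_partitions k. n \<in># M}.
      symfun_scale (inverse (of_nat (z_mset (M - {#n#})))) (p_mset (M - {#n#})))"
    by (intro sum.cong refl symfun_scale_p_mset_remove assms) auto
  also have "\<dots> = (if n \<le> k then h_sym (k - n) else 0)"
    by (subst sum_mset_partitions_remove[OF assms]) (simp add: h_sym_p_mset)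
  finally show ?thesis .
qed

section \<open>Existence, symmetry and non-degeneracy of the form\<close>

lemma symfun_form_exists:
  "\<exists>f :: 'k::field_char_0 symfun \<Rightarrow> 'k symfun \<Rightarrow> 'k. bilinear_form symfun_scale f \<and>
     (\<forall>M N. 0 \<notin># M \<longrightarrow> 0 \<notin># N \<longrightarrow> f (p_mset M) (p_mset N) = (if M = N then of_nat (z_mset M) else 0))"
proof -
  have vs: "vector_space ((*) :: 'k \<Rightarrow> 'k \<Rightarrow> 'k)" by unfold_locales (simp_all add: algebra_simps)
  \<comment> \<open>First extend in one argument: \<open>L N\<close> is the functional that pairs
    with \<open>p_mset N\<close>.\<close>
  have "\<forall>N. \<exists>T :: 'k symfun \<Rightarrow> 'k. Vector_Spaces.linear symfun_scale (*) T \<and>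
      (\<forall>M. 0 \<notin># M \<longrightarrow> T (p_mset M) = (if M = N then of_nat (z_mset M) else 0))"
    by (intro allI symfun_linear_extend[OF vs])
  then obtain L :: "nat multiset \<Rightarrow> 'k symfun \<Rightarrow> 'k" where
    L: "\<And>N. Vector_Spaces.linear symfun_scale (*) (L N)"
    "\<And>M N. 0 \<notin># M \<Longrightarrow> L N (p_mset M) = (if M = N then of_nat (z_mset M) else 0)" by metis
  have L': "L N (f + g) = L N f + L N g" "L N (symfun_scale c f) = c * L N f" for N f g c
    using L(1)[of N] by (auto simp: Vector_Spaces.linear_iff)
  \<comment> \<open>Then extend in the other: \<open>T g\<close> takes the value
    \<open>L M g\<close> at \<open>p_mset M\<close>. That \<open>T g f\<close> is linear in
    \<open>g\<close> as well is checked on basis elements \<open>f\<close>.\<close>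
  have "\<forall>g. \<exists>T :: 'k symfun \<Rightarrow> 'k. Vector_Spaces.linear symfun_scale (*) T \<and>
      (\<forall>M. 0 \<notin># M \<longrightarrow> T (p_mset M) = L M g)"
    by (intro allI symfun_linear_extend[OF vs])
  then obtain T :: "'k symfun \<Rightarrow> 'k symfun \<Rightarrow> 'k" where
    T: "\<And>g. Vector_Spaces.linear symfun_scale (*) (T g)"
    "\<And>M g. 0 \<notin># M \<Longrightarrow> T g (p_mset M) = L M g" by metis
  have T': "T h (f + g) = T h f + T h g" "T h (symfun_scale c f) = c * T h f" for h f g c
    using T(1)[of h] by (auto simp: Vector_Spaces.linear_iff)
  have "T (f + g) h = T f h + T g h" for f g h
    by (induction h rule: symfun_p_induct) (simp_all add: T T' L' algebra_simps)
  moreover have "T (symfun_scale c f) h = c * T f h" for f c h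
    by (induction h rule: symfun_p_induct) (simp_all add: T T' L' algebra_simps)
  ultimately have "bilinear_form symfun_scale (\<lambda>f g. T g f)"
    unfolding bilinear_form_def Vector_Spaces.linear_iff
    using vs symfun.vector_space_axioms by (auto simp: T')
  moreover have "T (p_mset N) (p_mset M) = (if M = N then of_nat (z_mset M) else 0)"
    if "0 \<notin># M" "0 \<notin># N" for M N
    using that by (simp add: T L)
  ultimately show ?thesis by blast
qed

lemma bilinear_formD:
  assumes "bilinear_form s f"
  shows "f (x + y) z = f x z + f y z" "f (s c x) z = c * f x z"
    "f z (x + y) = f z x + f z y" "f z (s c x) = c * f z x"
  using assms by (auto simp: bilinear_form_def Vector_Spaces.linear_iff)

text \<open>The definite description denotes: existence is carried over from multisets to
  partitions, and a bilinear form is determined by its values on pairs of basis elements.\<close>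

lemma hall_inner_spec:
  "bilinear_form symfun_scale (hall_inner :: 'k::field_char_0 symfun \<Rightarrow> _) \<and>
     (\<forall>\<mu> \<nu>. is_partition \<mu> \<longrightarrow> is_partition \<nu> \<longrightarrow>
        hall_inner (p_part \<mu> :: 'k symfun) (p_part \<nu>) = (if \<mu> = \<nu> then of_nat (z_part \<mu>) else 0))"
proof -
  let ?P = "\<lambda>f :: 'k symfun \<Rightarrow> 'k symfun \<Rightarrow> 'k. bilinear_form symfun_scale f \<and>
     (\<forall>\<mu> \<nu>. is_partition \<mu> \<longrightarrow> is_partition \<nu> \<longrightarrow>
        f (p_part \<mu>) (p_part \<nu>) = (if \<mu> = \<nu> then of_nat (z_part \<mu>) else 0))"
  obtain f :: "'k symfun \<Rightarrow> 'k symfun \<Rightarrow> 'k" where f: "bilinear_form symfun_scale f"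
    "\<And>M N. 0 \<notin># M \<Longrightarrow> 0 \<notin># N \<Longrightarrow> f (p_mset M) (p_mset N) = (if M = N then of_nat (z_mset M) else 0)"
    using symfun_form_exists by blast
  have "?P f"
    using f(1) by (auto simp: p_part_mset z_part_mset f(2) is_partition_0_notin is_partition_mset_inj)
  moreover have "g = f" if g: "?P g" for g
  proof -
    note fD = bilinear_formD[OF f(1)] and gD = bilinear_formD[OF conjunct1[OF g]]
    have basis: "g (p_mset M) (p_mset N) = f (p_mset M) (p_mset N)" if MN: "0 \<notin># M" "0 \<notin># N" for M N
    proof -
      obtain \<mu> \<nu> where "is_partition \<mu>" "mset \<mu> = M" "is_partition \<nu>" "mset \<nu> = N"
        using MN by (metis is_partition_of_mset)
      then show ?thesis using g \<open>?P f\<close> by (metis p_part_mset)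
    qed
    have "g x y = f x y" for x y
    proof (induction x rule: symfun_p_induct)
      case (p_mset M)
      show ?case by (induction y rule: symfun_p_induct) (simp_all add: basis p_mset fD gD)
    qed (simp_all add: fD gD)
    then show ?thesis by (simp add: fun_eq_iff)
  qed
  ultimately have "\<exists>!f. ?P f" by blast
  from theI'[OF this] show ?thesis unfolding hall_inner_def .
qed

lemmas hall_inner_add_left = bilinear_formD(1)[OF conjunct1[OF hall_inner_spec]]
  and hall_inner_scale_left = bilinear_formD(2)[OF conjunct1[OF hall_inner_spec]]
  and hall_inner_add_right = bilinear_formD(3)[OF conjunct1[OF hall_inner_spec]]
  and hall_inner_scale_right = bilinear_formD(4)[OF conjunct1[OF hall_inner_spec]]

lemmas hall_inner_simps =
  hall_inner_add_left hall_inner_scale_left hall_inner_add_right hall_inner_scale_right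

lemma hall_inner_sum_left: "hall_inner (sum f A) g = (\<Sum>x\<in>A. hall_inner (f x) g)"
  using hall_inner_scale_left[of 0 0 g]
  by (induction A rule: infinite_finite_induct) (auto simp: hall_inner_simps)

lemma hall_inner_sum_right: "hall_inner g (sum f A) = (\<Sum>x\<in>A. hall_inner g (f x))"
  using hall_inner_scale_right[of g 0 0]
  by (induction A rule: infinite_finite_induct) (auto simp: hall_inner_simps)

lemma hall_inner_0_right [simp]: "hall_inner f 0 = 0"
  using hall_inner_scale_right[of f 0 0] by simp

lemma hall_inner_p_mset:
  assumes "0 \<notin># M" "0 \<notin># N"
  shows "hall_inner (p_mset M :: 'k::field_char_0 symfun) (p_mset N) = (if M = N then of_nat (z_mset M) else 0)"
proof -
  obtain \<mu> \<nu> where "is_partition \<mu>" "mset \<mu> = M" "is_partition \<nu>" "mset \<nu> = N"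
    using assms by (metis is_partition_of_mset)
  then show ?thesis
    using hall_inner_spec[where 'k = 'k] by (metis p_part_mset z_part_mset)
qed

lemma hall_inner_commute: "hall_inner f g = hall_inner g f"
proof (induction f rule: symfun_p_induct)
  case (p_mset M)
  then show ?case
    by (induction g rule: symfun_p_induct) (simp_all add: hall_inner_p_mset hall_inner_simps)
qed (simp_all add: hall_inner_simps)

text \<open>The \<open>p_mset N\<close> are orthogonal with \<open>z_mset N \<noteq> 0\<close>, so
  pairing with one of them isolates a single coefficient of \<open>f\<close>.\<close>

lemma hall_inner_eq_0:
  fixes f :: "'k::field_char_0 symfun"
  assumes "\<And>N. 0 \<notin># N \<Longrightarrow> hall_inner f (p_mset N) = 0"
  shows "f = 0"
proof -
  have "f \<in> symfun.span (p_mset ` {M. 0 \<notin># M})" by (simp add: p_mset_span)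
  then obtain t r where t: "finite t" "t \<subseteq> p_mset ` {M. 0 \<notin># M}" "f = (\<Sum>x\<in>t. symfun_scale (r x) x)"
    unfolding symfun.span_explicit by blast
  have "r x = 0" if x: "x \<in> t" for x
  proof -
    from x t(2) obtain N where N: "0 \<notin># N" "x = p_mset N" by auto
    have *: "hall_inner y x = (if y = x then of_nat (z_mset N) else 0)" if "y \<in> t" for y
    proof -
      from that t(2) obtain M where M: "0 \<notin># M" "y = p_mset M" by auto
      have "y = x \<longleftrightarrow> M = N"
        unfolding M(2) N(2) using inj_on_eq_iff[OF inj_on_p_mset, of M N] M N by simp
      then show ?thesis using M N by (simp add: hall_inner_p_mset)
    qed
    have "0 = hall_inner f x" using assms[OF N(1)] N by simp
    also have "\<dots> = (\<Sum>y\<in>t. r y * (if y = x then of_nat (z_mset N) else 0))"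
      unfolding t(3) hall_inner_sum_left hall_inner_scale_left by (intro sum.cong refl) (simp add: *)
    also have "\<dots> = r x * of_nat (z_mset N)" using t(1) x by (subst sum.remove[of _ x]) auto
    finally show ?thesis using z_mset_pos[OF N(1)] by simp
  qed
  then show ?thesis unfolding t(3) by simp
qed

lemma hall_inner_eqI:
  fixes f g :: "'k::field_char_0 symfun"
  assumes "\<And>x. hall_inner f x = hall_inner g x"
  shows "f = g"
proof -
  have "hall_inner (f + symfun_scale (-1) g) x = 0" for x
    by (simp only: hall_inner_simps assms) simp
  from hall_inner_eq_0[OF this] have "f + symfun_scale (-1) g = 0" .
  then show ?thesis by simp
qed

text \<open>On basis elements \<open>p_mset M\<close> and \<open>p_mset N\<close> both sides vanish
  unless \<open>N = add_mset n M\<close>. In that case the factor \<open>n * Suc (count M n)\<close>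
  from \<open>z_mset_add\<close> is the one produced by the derivative.\<close>

lemma hall_inner_p_times:
  assumes "n > 0"
  shows "hall_inner (p_sym n * f) g = hall_inner f (p_deriv n g)"
proof (induction f rule: symfun_p_induct)
  case (p_mset M)
  show ?case
  proof (induction g rule: symfun_p_induct)
    case (p_mset N)
    show ?case
    proof (cases "n \<in># N")
      case True
      then obtain N' where N': "N = add_mset n N'" by (auto dest: multi_member_split)
      have "0 \<notin># add_mset n M" "0 \<notin># N'" using assms \<open>0 \<notin># M\<close> p_mset N' by auto
      then show ?thesis using p_mset \<open>0 \<notin># M\<close> unfolding p_mset_add[symmetric]
        by (auto simp: p_deriv_p_mset hall_inner_p_mset hall_inner_simps N' z_mset_add simp del: p_mset_add)
    next
      case False
      have "0 \<notin># add_mset n M" using assms \<open>0 \<notin># M\<close> by auto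
      moreover have "add_mset n M \<noteq> N" using False by auto
      ultimately show ?thesis using p_mset \<open>0 \<notin># M\<close> False unfolding p_mset_add[symmetric]
        by (simp add: p_deriv_p_mset hall_inner_p_mset hall_inner_simps not_in_iff del: p_mset_add)
    qed
  qed (simp_all add: p_deriv_add p_deriv_scale hall_inner_simps)
qed (simp_all add: hall_inner_simps algebra_simps symfun_scale_mult_right)

section \<open>Duality between products of complete functions and monomials\<close>

definition h_expo :: "(nat \<Rightarrow>\<^sub>0 nat) \<Rightarrow> 'a::comm_ring_1 symfun" where
  "h_expo \<alpha> = (\<Prod>i\<in>Poly_Mapping.keys \<alpha>. h_sym (Poly_Mapping.lookup \<alpha> i))"

lemma h_expo_superset:
  assumes "finite A" "Poly_Mapping.keys \<alpha> \<subseteq> A"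
  shows "h_expo \<alpha> = (\<Prod>i\<in>A. h_sym (Poly_Mapping.lookup \<alpha> i))"
  unfolding h_expo_def using assms by (intro prod.mono_neutral_left) (auto simp: in_keys_iff)

text \<open>Leibniz's rule over the factors. The index set and the shifted exponents are those of
  \<open>symfun_coeff_p_times\<close>, so the two formulas can be matched term by term.\<close>

lemma p_deriv_h_expo:
  assumes "n > 0"
  shows "p_deriv n (h_expo \<alpha> :: 'k::field_char_0 symfun) =
    (\<Sum>i\<in>{i\<in>Poly_Mapping.keys \<alpha>. n \<le> Poly_Mapping.lookup \<alpha> i}. h_expo (\<alpha> - Poly_Mapping.single i n))"
proof -
  let ?K = "Poly_Mapping.keys \<alpha>" and ?h = "\<lambda>i. h_sym (Poly_Mapping.lookup \<alpha> i) :: 'k symfun"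
  have "p_deriv n (h_expo \<alpha> :: 'k symfun) = (\<Sum>i\<in>?K. p_deriv n (?h i) * prod ?h (?K - {i}))"
    by (simp add: h_expo_def p_deriv_prod)
  also have "\<dots> = (\<Sum>i\<in>{i\<in>?K. n \<le> Poly_Mapping.lookup \<alpha> i}. p_deriv n (?h i) * prod ?h (?K - {i}))"
    by (rule sum.mono_neutral_right) (auto simp: p_deriv_h_sym[OF assms])
  also have "\<dots> = (\<Sum>i\<in>{i\<in>?K. n \<le> Poly_Mapping.lookup \<alpha> i}. h_expo (\<alpha> - Poly_Mapping.single i n))"
  proof (intro sum.cong refl)
    fix i assume i: "i \<in> {i\<in>?K. n \<le> Poly_Mapping.lookup \<alpha> i}"
    have "h_expo (\<alpha> - Poly_Mapping.single i n) =
        (\<Prod>j\<in>?K. h_sym (Poly_Mapping.lookup (\<alpha> - Poly_Mapping.single i n) j) :: 'k symfun)"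
      by (rule h_expo_superset) (auto simp: in_keys_iff lookup_minus)
    also have "\<dots> = h_sym (Poly_Mapping.lookup \<alpha> i - n) * prod ?h (?K - {i})"
      using i by (subst prod.remove[of _ i])
        (auto simp: lookup_minus lookup_single when_def intro!: prod.cong arg_cong2[of _ _ _ _ "(*)"])
    finally show "p_deriv n (?h i) * prod ?h (?K - {i}) = h_expo (\<alpha> - Poly_Mapping.single i n)"
      using i by (simp add: p_deriv_h_sym[OF assms])
  qed
  finally show ?thesis .
qed

lemma symfun_coeff_0_mult: "symfun_coeff (f * g) 0 = symfun_coeff f 0 * symfun_coeff g 0"
proof -
  have "expo_splits 0 = {(0, 0)}"
  proof -
    have "x = (0, 0)" if x: "x \<in> expo_splits 0" for x
    proof -
      have "Poly_Mapping.lookup (fst x) i + Poly_Mapping.lookup (snd x) i = 0" for i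
        using x unfolding lookup_add[symmetric] by (simp add: expo_splits_def case_prod_unfold)
      then show ?thesis by (auto intro!: prod_eqI poly_mapping_eqI)
    qed
    moreover have "(0, 0) \<in> expo_splits 0" by (simp add: expo_splits_def)
    ultimately show ?thesis by blast
  qed
  then show ?thesis by (simp add: times_symfun.rep_eq series_mult_def)
qed

lemma symfun_coeff_0_prod: "symfun_coeff (prod f A) 0 = (\<Prod>x\<in>A. symfun_coeff (f x) 0)"
  by (induction A rule: infinite_finite_induct) (auto simp: symfun_coeff_0_mult one_symfun.rep_eq)

lemma hall_inner_1_left: "hall_inner 1 f = symfun_coeff f 0"
proof (induction f rule: symfun_p_induct)
  case (p_mset M)
  have "symfun_coeff (p_mset M :: 'a symfun) 0 = (if M = {#} then 1 else 0)"
    using symfun_coeff_p_mset_nonzero[OF p_mset, of 0, where 'a = 'a] p_mset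
    by (cases M) (auto simp: one_symfun.rep_eq)
  then show ?case using hall_inner_p_mset[of "{#}" M, where 'k = 'a] p_mset by auto
qed (simp_all add: hall_inner_simps symfun_coeff_simps)

text \<open>A factor \<open>p_sym n\<close> on the left moves to the right as
  \<open>p_deriv n\<close>, which lowers one exponent by \<open>n\<close> exactly as the coefficient
  formula for a product with \<open>p_sym n\<close> does. What remains is the pairing with 1, the
  constant term.\<close>

lemma hall_inner_h_expo: "hall_inner f (h_expo \<alpha>) = symfun_coeff f \<alpha>"
proof (induction f arbitrary: \<alpha> rule: symfun_p_induct)
  case (p_mset M)
  then show ?case
  proof (induction M arbitrary: \<alpha>)
    case empty
    have "symfun_coeff (h_expo \<alpha> :: 'a symfun) 0 = (if \<alpha> = 0 then 1 else 0)"
    proof (cases "\<alpha> = 0")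
      case False
      then obtain i where "i \<in> Poly_Mapping.keys \<alpha>" by (metis all_not_in_conv keys_eq_empty)
      then have "(\<Prod>i\<in>Poly_Mapping.keys \<alpha>. symfun_coeff (h_sym (Poly_Mapping.lookup \<alpha> i) :: 'a symfun) 0) = 0"
        by (intro prod_zero bexI[of _ i]) (auto simp: h_sym.rep_eq in_keys_iff)
      then show ?thesis using False by (simp add: h_expo_def symfun_coeff_0_prod)
    qed (simp add: h_expo_def one_symfun.rep_eq)
    then show ?case by (simp add: hall_inner_1_left one_symfun.rep_eq)
  next
    case (add n M)
    then have n: "n > 0" by auto
    then show ?case using add
      by (simp add: hall_inner_p_times p_deriv_h_expo hall_inner_sum_right symfun_coeff_p_times)
  qed
qed (simp_all add: hall_inner_simps symfun_coeff_simps)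

text \<open>Adjoints are not automatic in infinite dimension. Here they are composed from the
  adjoints \<open>p_deriv n\<close> of multiplication by \<open>p_sym n\<close> and extended
  linearly in \<open>g\<close>.\<close>

lemma hall_inner_adjoint_exists:
  "\<exists>T. Vector_Spaces.linear symfun_scale symfun_scale T \<and>
     (\<forall>f x. hall_inner (T f) x = hall_inner f (g * x :: 'k::field_char_0 symfun))"
proof (induction g rule: symfun_p_induct)
  case (p_mset M)
  then show ?case
  proof (induction M)
    case empty
    show ?case by (intro exI[of _ "\<lambda>f. f"]) (auto simp: Vector_Spaces.linear_iff symfun.vector_space_axioms)
  next
    case (add n M)
    then obtain T where T: "Vector_Spaces.linear symfun_scale symfun_scale T"
      "\<And>f x. hall_inner (T f) x = hall_inner f (p_mset M * x :: 'k symfun)" by auto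
    have "hall_inner (p_deriv n (T f)) x = hall_inner f (p_mset (add_mset n M) * x)" for f x
      using add.prems hall_inner_p_times[of n x "T f"]
      by (simp add: hall_inner_commute[of "p_deriv n (T f)"] hall_inner_commute[of _ "T f"] T mult_ac)
    then show ?case
      by (intro exI[of _ "\<lambda>f. p_deriv n (T f)"])
         (use T in \<open>auto simp: Vector_Spaces.linear_iff p_deriv_add p_deriv_scale\<close>)
  qed
next
  case (add g h)
  then obtain S T where "Vector_Spaces.linear symfun_scale symfun_scale S"
    "\<And>f x. hall_inner (S f) x = hall_inner f (g * x :: 'k symfun)"
    "Vector_Spaces.linear symfun_scale symfun_scale T"
    "\<And>f x. hall_inner (T f) x = hall_inner f (h * x :: 'k symfun)" by auto
  then show ?case
    by (intro exI[of _ "\<lambda>f. S f + T f"])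
       (auto simp: Vector_Spaces.linear_iff hall_inner_simps algebra_simps symfun.scale_right_distrib)
next
  case (scale c g)
  then obtain S where "Vector_Spaces.linear symfun_scale symfun_scale S"
    "\<And>f x. hall_inner (S f) x = hall_inner f (g * x :: 'k symfun)" by auto
  then show ?case
    by (intro exI[of _ "\<lambda>f. symfun_scale c (S f)"])
       (auto simp: Vector_Spaces.linear_iff hall_inner_simps symfun_scale_mult_left symfun.scale_right_distrib)
qed

lemma hall_inner_h_perp: "hall_inner (h_perp k f) x = hall_inner f (h_sym k * x :: 'k::field_char_0 symfun)"
proof -
  let ?P = "\<lambda>T. Vector_Spaces.linear symfun_scale symfun_scale T \<and>
     (\<forall>f g. hall_inner (T f) g = hall_inner f (h_sym k * g :: 'k symfun))"
  have "\<exists>!T. ?P T"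
  proof (rule ex_ex1I)
    show "\<exists>T. ?P T" by (rule hall_inner_adjoint_exists)
    fix S T assume "?P S" "?P T"
    then show "S = T" by (intro ext hall_inner_eqI) auto
  qed
  from theI'[OF this] show ?thesis unfolding h_perp_def by blast
qed

text \<open>The map is diagonal on the basis, the eigenvalue at \<open>p_mset M\<close> being the
  product of the parameters over the parts of \<open>M\<close>. It is unique because the power sums
  generate the algebra.\<close>

lemma plethysm_hom_spec:
  fixes a :: "int \<Rightarrow> 'k::field_char_0"
  shows "Vector_Spaces.linear symfun_scale symfun_scale (plethysm_hom a) \<and> plethysm_hom a 1 = 1 \<and>
     (\<forall>f g. plethysm_hom a (f * g) = plethysm_hom a f * plethysm_hom a g) \<and>
     (\<forall>j\<ge>1. plethysm_hom a (p_sym j) = symfun_scale (a (int j)) (p_sym j))"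
proof -
  let ?P = "\<lambda>\<theta>. Vector_Spaces.linear symfun_scale symfun_scale \<theta> \<and>
     \<theta> 1 = 1 \<and> (\<forall>f g. \<theta> (f * g) = \<theta> f * \<theta> g) \<and>
     (\<forall>j\<ge>1. \<theta> (p_sym j) = symfun_scale (a (int j)) (p_sym j))"
  obtain \<theta> :: "'k symfun \<Rightarrow> 'k symfun" where \<theta>: "Vector_Spaces.linear symfun_scale symfun_scale \<theta>"
    "\<And>M. 0 \<notin># M \<Longrightarrow> \<theta> (p_mset M) = symfun_scale (prod_mset (image_mset (\<lambda>j. a (int j)) M)) (p_mset M)"
    using symfun_linear_extend[OF symfun.vector_space_axioms,
        of "\<lambda>M. symfun_scale (prod_mset (image_mset (\<lambda>j. a (int j)) M)) (p_mset M)"] by auto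
  have lin: "\<theta> (f + g) = \<theta> f + \<theta> g" "\<theta> (symfun_scale c f) = symfun_scale c (\<theta> f)" for f g c
    using \<theta>(1) by (auto simp: Vector_Spaces.linear_iff)
  have "\<theta> (f * g) = \<theta> f * \<theta> g" for f g
  proof (induction f rule: symfun_p_induct)
    case (p_mset M)
    then show ?case
    proof (induction g rule: symfun_p_induct)
      case (p_mset N)
      then show ?case
        by (simp add: \<theta> p_mset_union[symmetric] symfun_scale_mult_left symfun_scale_mult_right mult.commute)
    qed (simp_all add: lin algebra_simps symfun_scale_mult_right)
  qed (simp_all add: lin algebra_simps symfun_scale_mult_left symfun_scale_mult_right)
  moreover have "\<theta> (p_sym j) = symfun_scale (a (int j)) (p_sym j)" if "j \<ge> 1" for j
    using \<theta>(2)[of "{#j#}"] that by simp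
  moreover have "\<theta> 1 = 1" using \<theta>(2)[of "{#}"] by simp
  ultimately have P: "?P \<theta>" using \<theta>(1) by blast
  have "\<exists>!\<theta>. ?P \<theta>"
  proof (rule ex1I)
    fix \<phi> assume \<phi>: "?P \<phi>"
    have "\<phi> (p_mset M) = \<theta> (p_mset M)" if "0 \<notin># M" for M
      using that
    proof (induction M)
      case (add n M)
      then have "n \<ge> 1" by (cases n) auto
      then show ?case using add \<phi> P by simp
    qed (use \<phi> P in simp)
    then have "\<phi> f = \<theta> f" for f
      using \<phi> by (induction f rule: symfun_p_induct) (auto simp: lin Vector_Spaces.linear_iff)
    then show "\<phi> = \<theta>" by (rule ext)
  qed (rule P)
  from theI'[OF this] show ?thesis unfolding plethysm_hom_def .
qed

lemma plethysm_hom_add: "plethysm_hom a (f + g) = plethysm_hom a f + plethysm_hom a g"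
  and plethysm_hom_scale: "plethysm_hom a (symfun_scale c f) = symfun_scale c (plethysm_hom a f)"
  and plethysm_hom_1: "plethysm_hom a 1 = 1"
  and plethysm_hom_mult: "plethysm_hom a (f * g) = plethysm_hom a f * plethysm_hom a g"
  and plethysm_hom_p_sym: "j > 0 \<Longrightarrow> plethysm_hom a (p_sym j) = symfun_scale (a (int j)) (p_sym j)"
  using plethysm_hom_spec[of a] by (auto simp: Vector_Spaces.linear_iff)

section \<open>Representing functionals and actions of symmetric functions\<close>

text \<open>Orthogonality dictates the coefficient of \<open>u\<close> at \<open>p_mset M\<close>:
  the value of \<open>\<phi>\<close> there divided by \<open>z_mset M\<close>. Finite support makes
  \<open>u\<close> a finite combination.\<close>

lemma hall_inner_represent:
  fixes \<phi> :: "'k::field_char_0 symfun \<Rightarrow> 'k"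
  assumes add: "\<And>f g. \<phi> (f + g) = \<phi> f + \<phi> g" and scale: "\<And>c f. \<phi> (symfun_scale c f) = c * \<phi> f"
    and fin: "finite {M. 0 \<notin># M \<and> \<phi> (p_mset M) \<noteq> 0}"
  shows "\<exists>u. \<forall>f. hall_inner u f = \<phi> f"
proof -
  let ?S = "{M. 0 \<notin># M \<and> \<phi> (p_mset M) \<noteq> 0}"
  define u where "u = (\<Sum>M\<in>?S. symfun_scale (\<phi> (p_mset M) / of_nat (z_mset M)) (p_mset M))"
  have "hall_inner u f = \<phi> f" for f
  proof (induction f rule: symfun_p_induct)
    case (p_mset N)
    have "hall_inner u (p_mset N) =
        (\<Sum>M\<in>?S. if M = N then \<phi> (p_mset M) / of_nat (z_mset M) * of_nat (z_mset M) else 0)"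
      unfolding u_def hall_inner_sum_left hall_inner_scale_left
      by (intro sum.cong refl) (auto simp: hall_inner_p_mset p_mset)
    also have "\<dots> = \<phi> (p_mset N)"
      using fin p_mset z_mset_pos[OF p_mset] by (subst sum.delta) auto
    finally show ?case .
  qed (simp_all add: hall_inner_simps add scale)
  then show ?thesis by blast
qed

locale symfun_action = vector_space scale
  for scale :: "'k::field_char_0 \<Rightarrow> 'v::ab_group_add \<Rightarrow> 'v" +
  fixes A :: "'k symfun \<Rightarrow> 'v \<Rightarrow> 'v"
  assumes act_add_left: "A (f + g) x = A f x + A g x"
    and act_scale_left: "A (symfun_scale c f) x = scale c (A f x)"
    and act_add_right: "A f (x + y) = A f x + A f y"
    and act_scale_right: "A f (scale c x) = scale c (A f x)"
    and act_one: "A 1 x = x"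
    and act_mult: "A (f * g) x = A f (A g x)"
begin

lemmas act_simps = act_add_left act_scale_left act_add_right act_scale_right act_one

lemma act_zero_left [simp]: "A 0 x = 0"
  using act_scale_left[of 0 0 x] by simp

lemma act_sum_left: "A (sum f S) x = (\<Sum>i\<in>S. A (f i) x)"
  by (induction S rule: infinite_finite_induct) (auto simp: act_simps)

text \<open>The order of application is opposite to that in \<open>act_mult\<close>; commutativity
  of the algebra reconciles them.\<close>

lemma act_fold: "fold (\<lambda>i. A (f i)) xs x = A (prod_list (map f xs)) x"
  by (induction xs arbitrary: x) (auto simp: act_one act_mult[symmetric] mult.commute)

text \<open>This turns the string of operators in a coefficient of \<open>F_skew\<close> or
  \<open>G_skew\<close> into the action of one symmetric function. Exponents equal to 0 contribute
  \<open>h_sym 0 = 1\<close>.\<close>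

lemma act_fold_h_expo:
  "fold (\<lambda>i. A (h_sym (Poly_Mapping.lookup \<alpha> i))) [0..<Poly_Mapping.degree \<alpha>] x = A (h_expo \<alpha>) x"
proof -
  have "h_expo \<alpha> = (\<Prod>i\<in>set [0..<Poly_Mapping.degree \<alpha>]. h_sym (Poly_Mapping.lookup \<alpha> i) :: 'k symfun)"
    by (rule h_expo_superset) (auto dest: in_keys_less_degree)
  also have "\<dots> = prod_list (map (\<lambda>i. h_sym (Poly_Mapping.lookup \<alpha> i)) [0..<Poly_Mapping.degree \<alpha>])"
    by (rule prod.distinct_set_conv_list) simp
  finally show ?thesis by (simp add: act_fold)
qed

end

text \<open>In characteristic 0 the symmetric functions are the polynomial ring in the power sums,
  so commuting linear operators can be substituted for these.\<close>

lemma symfun_action_exists: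
  fixes scale :: "'k::field_char_0 \<Rightarrow> 'v::ab_group_add \<Rightarrow> 'v" and C :: "nat \<Rightarrow> 'v \<Rightarrow> 'v"
  assumes vs: "vector_space scale"
    and C_add: "\<And>n x y. n > 0 \<Longrightarrow> C n (x + y) = C n x + C n y"
    and C_scale: "\<And>n c x. n > 0 \<Longrightarrow> C n (scale c x) = scale c (C n x)"
    and C_comm: "\<And>m n x. m > 0 \<Longrightarrow> n > 0 \<Longrightarrow> C m (C n x) = C n (C m x)"
  shows "\<exists>A. symfun_action scale A \<and> (\<forall>n>0. A (p_sym n) = C n)"
proof -
  interpret vector_space scale by fact
  \<comment> \<open>\<open>fold_mset\<close> requires a family that commutes throughout, while the
    assumptions concern positive indices. Index 0 gets the identity; it occurs in no basis
    element.\<close>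
  define C' where "C' n = (if n = 0 then id else C n)" for n
  interpret C': comp_fun_commute C'
    by standard (auto simp: C'_def fun_eq_iff C_comm)
  define g where "g x M = fold_mset C' x M" for x and M :: "nat multiset"
  have g_add: "g (x + y) M = g x M + g y M" for x y M
    by (induction M) (auto simp: g_def C'_def C_add)
  have g_scale: "g (scale c x) M = scale c (g x M)" for c x M
    by (induction M) (auto simp: g_def C'_def C_scale)
  have g_union: "g x (M + N) = g (g x N) M" for x M N
    by (induction M) (auto simp: g_def)
  have "\<forall>x. \<exists>T. Vector_Spaces.linear symfun_scale scale T \<and> (\<forall>M. 0 \<notin># M \<longrightarrow> T (p_mset M) = g x M)"
    by (intro allI symfun_linear_extend vs)
  then obtain T where T: "\<And>x. Vector_Spaces.linear symfun_scale scale (T x)"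
    "\<And>x M. 0 \<notin># M \<Longrightarrow> T x (p_mset M) = g x M" by metis
  have T': "T x (f + h) = T x f + T x h" "T x (symfun_scale c f) = scale c (T x f)" for x f h c
    using T(1)[of x] by (auto simp: Vector_Spaces.linear_iff)
  have "T (x + y) f = T x f + T y f" for x y f
    by (induction f rule: symfun_p_induct) (simp_all add: T T' g_add algebra_simps scale_right_distrib)
  moreover have "T (scale c x) f = scale c (T x f)" for c x f
    by (induction f rule: symfun_p_induct) (simp_all add: T T' g_scale scale_right_distrib mult.commute)
  moreover have "T x 1 = x" for x using T(2)[of "{#}" x] by (simp add: g_def)
  moreover have "T x (f * h) = T (T x h) f" for x f h
  proof (induction f rule: symfun_p_induct)
    case (p_mset M)
    show ?case
    proof (induction h rule: symfun_p_induct)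
      case (p_mset N)
      then show ?case using \<open>0 \<notin># M\<close> by (simp add: T g_union flip: p_mset_union)
    \<comment> \<open>\<open>calculation\<close> holds the linearity in the vector collected so far,
      needed because \<open>h\<close> enters on the right through the vector
      \<open>T x h\<close>.\<close>
    qed (use calculation in \<open>simp_all add: T' distrib_left symfun_scale_mult_right\<close>)
  qed (simp_all add: T' distrib_right symfun_scale_mult_left)
  ultimately have "symfun_action scale (\<lambda>f x. T x f)"
    by unfold_locales (simp_all add: T')
  moreover have "T x (p_sym n) = C n x" if "n > 0" for n x
    using T(2)[of "{#n#}" x] that by (simp add: g_def C'_def)
  ultimately show ?thesis by (intro exI[of _ "\<lambda>f x. T x f"]) auto
qed

section \<open>Graded representations of the Heisenberg algebra\<close>

lemma ring_of_type_algebra_ring: "ring (ring_of_type_algebra :: 'a::ring_1 ring)"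
proof -
  have "\<exists>y. x + y = 0" for x :: 'a using add.right_inverse by blast
  then show ?thesis
    unfolding ring_of_type_algebra_def using add.right_inverse
    by unfold_locales (auto simp: algebra_simps Units_def)
qed

context graded_heis_rep
begin

text \<open>Composition of the quotient map with \<open>\<rho>\<close>: computations can then be
  done with elements of the free algebra instead of cosets.\<close>

lemma class_hom: "(\<lambda>x. \<rho> (heis_class a x)) \<in> ring_hom ring_of_type_algebra (endo_ring scale)"
proof -
  interpret R: ring "ring_of_type_algebra :: 'k free_heis ring" by (rule ring_of_type_algebra_ring)
  have "ideal (heis_ideal a) ring_of_type_algebra"
    unfolding heis_ideal_def by (rule R.genideal_ideal) (simp add: ring_of_type_algebra_def)
  from ideal.rcos_ring_hom[OF this]
  have "heis_class a \<in> ring_hom ring_of_type_algebra (heis_alg a)"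
    by (simp add: heis_class_def[abs_def] heis_alg_def)
  from ring_hom_trans[OF this rep_ring_hom] show ?thesis by (simp add: comp_def)
qed

lemma rho_add: "\<rho> (heis_class a (x + y)) z = \<rho> (heis_class a x) z + \<rho> (heis_class a y) z"
  and rho_mult: "\<rho> (heis_class a (x * y)) z = \<rho> (heis_class a x) (\<rho> (heis_class a y) z)"
  using ring_hom_memE(2,3)[OF class_hom, of x y]
  by (simp_all add: ring_of_type_algebra_def endo_ring_def)

lemma rho_linear: "Vector_Spaces.linear scale scale (\<rho> (heis_class a x))"
  using ring_hom_memE(1)[OF class_hom, of x] by (simp add: ring_of_type_algebra_def endo_ring_def)

lemma rho_vec_add: "\<rho> (heis_class a x) (y + z) = \<rho> (heis_class a x) y + \<rho> (heis_class a x) z"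
  and rho_vec_scale: "\<rho> (heis_class a x) (scale c y) = scale c (\<rho> (heis_class a x) y)"
  using rho_linear[of x] by (auto simp: Vector_Spaces.linear_iff)

lemma rho_const: "\<rho> (heis_class a (free_const c)) z = scale c z"
  by (simp add: rep_scalar)

lemma rho_0: "\<rho> (heis_class a 0) z = 0"
  using rho_const[of 0 z] by (simp add: free_const_def)

lemma rho_1: "\<rho> (heis_class a 1) z = z"
  using rho_const[of 1 z] by (simp add: free_const_def)

lemma rho_sum: "\<rho> (heis_class a (sum f S)) z = (\<Sum>i\<in>S. \<rho> (heis_class a (f i)) z)"
  by (induction S rule: infinite_finite_induct) (auto simp: rho_0 rho_add)

lemma rho_relator:
  assumes "x \<in> heis_relators a" shows "\<rho> (heis_class a x) z = 0"
proof -
  interpret R: ring "ring_of_type_algebra :: 'k free_heis ring" by (rule ring_of_type_algebra_ring)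
  have sub: "heis_relators a \<subseteq> carrier ring_of_type_algebra" by (simp add: ring_of_type_algebra_def)
  interpret I: ideal "heis_ideal a" "ring_of_type_algebra :: 'k free_heis ring"
    unfolding heis_ideal_def by (rule R.genideal_ideal[OF sub])
  have "x \<in> heis_ideal a" unfolding heis_ideal_def using R.genideal_self[OF sub] assms by auto
  moreover have "0 \<in> heis_ideal a"
    using I.zero_closed by (simp add: ring_of_type_algebra_def)
  ultimately have "heis_class a x = heis_class a 0"
    by (simp add: heis_class_def I.a_rcos_const)
  then show ?thesis by (simp add: rho_0)
qed

lemma rho_commute:
  assumes "k \<noteq> 0" "l \<noteq> 0"
  shows "\<rho> (heis_B a k) (\<rho> (heis_B a l) z) =
    \<rho> (heis_B a l) (\<rho> (heis_B a k) z) + scale (if k = - l then of_int k * a k else 0) z"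
proof -
  let ?c = "free_const (if k = - l then of_int k * a k else 0)"
  let ?r = "free_gen k * free_gen l - free_gen l * free_gen k - ?c"
  have "?r \<in> heis_relators a" using assms unfolding heis_relators_def by blast
  from rho_relator[OF this] have "\<rho> (heis_class a (?r + (free_gen l * free_gen k + ?c))) z =
      \<rho> (heis_class a (free_gen l * free_gen k + ?c)) z" by (simp only: rho_add add_0)
  moreover have "?r + (free_gen l * free_gen k + ?c) = free_gen k * free_gen l" by simp
  ultimately show ?thesis
    by (simp only: rho_add rho_mult rho_const heis_B_def)
qed

section \<open>Coordinates in the distinguished basis and the grading\<close>

lemma ip_add_left: "ip (x + y) z = ip x z + ip y z"
  and ip_scale_left: "ip (scale c x) z = c * ip x z"
  by (rule bilinear_formD[OF ip_bilinear])+

lemma ip_sum_left: "ip (sum f S) z = (\<Sum>i\<in>S. ip (f i) z)"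
  using ip_scale_left[of 0 0 z] by (induction S rule: infinite_finite_induct) (auto simp: ip_add_left)

lemma basis_expansion:
  obtains T where "finite T" "x = (\<Sum>t\<in>T. scale (ip x (v t)) (v t))" "\<And>t. t \<notin> T \<Longrightarrow> ip x (v t) = 0"
proof -
  have "x \<in> span (range v)" by (simp add: basis_span)
  then obtain S r where S: "finite S" "S \<subseteq> range v" "x = (\<Sum>w\<in>S. scale (r w) w)"
    unfolding span_explicit by blast
  from S(1,2) obtain T where T: "finite T" "S = v ` T" by (metis finite_subset_image)
  have x: "x = (\<Sum>t\<in>T. scale (r (v t)) (v t))"
    unfolding S(3) T(2) by (subst sum.reindex) (auto intro: inj_on_subset[OF basis_inj])
  have ip: "ip x (v t) = (if t \<in> T then r (v t) else 0)" for t
    using T(1) by (subst x) (simp add: ip_sum_left ip_scale_left ip_basis if_distrib cong: if_cong)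
  show ?thesis
  proof
    show "finite T" by fact
    show "x = (\<Sum>t\<in>T. scale (ip x (v t)) (v t))" by (subst x) (simp add: ip)
  qed (simp add: ip)
qed

text \<open>Only those \<open>t\<close> matter at which neither factor vanishes, so \<open>T\<close>
  may come from the finite support of \<open>x\<close> or from that of \<open>L\<close>. The
  identities for \<open>G\<close> use the former, those for \<open>F\<close> the latter.\<close>

lemma functional_expansion:
  fixes L :: "'v \<Rightarrow> 'k"
  assumes L: "\<And>x y. L (x + y) = L x + L y" "\<And>c x. L (scale c x) = c * L x"
    and T: "finite T" "\<And>t. t \<notin> T \<Longrightarrow> ip x (v t) = 0 \<or> L (v t) = 0"
  shows "L x = (\<Sum>t\<in>T. ip x (v t) * L (v t))"
proof -
  obtain S where S: "finite S" "x = (\<Sum>t\<in>S. scale (ip x (v t)) (v t))" "\<And>t. t \<notin> S \<Longrightarrow> ip x (v t) = 0"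
    by (rule basis_expansion[of x]) blast
  have "L (sum f S) = (\<Sum>t\<in>S. L (f t))" for f
    using S(1) L(2)[of 0 0] by (induction S rule: finite_induct) (auto simp: L)
  then have "L x = (\<Sum>t\<in>S. ip x (v t) * L (v t))" by (subst S(2)) (simp add: L)
  also have "\<dots> = (\<Sum>t\<in>T. ip x (v t) * L (v t))"
    using S T by (intro sum.mono_neutral_cong) auto
  finally show ?thesis .
qed

text \<open>Two homogeneous decompositions of \<open>x\<close> must coincide: the one concentrated
  in degree \<open>n\<close>, and the basis expansion grouped by degree.\<close>

lemma ip_deg:
  assumes "x \<in> Vgr n" "ip x (v s) \<noteq> 0" shows "deg s = n"
proof (rule ccontr)
  assume "deg s \<noteq> n"
  obtain T where T: "finite T" "x = (\<Sum>t\<in>T. scale (ip x (v t)) (v t))" "\<And>t. t \<notin> T \<Longrightarrow> ip x (v t) = 0"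
    by (rule basis_expansion[of x]) blast
  define f where "f d = (\<Sum>t\<in>{t\<in>T. deg t = d}. scale (ip x (v t)) (v t))" for d
  define g where "g d = (if d = n then x else 0)" for d
  let ?P = "\<lambda>f. (\<forall>n. f n \<in> Vgr n) \<and> finite {n. f n \<noteq> 0} \<and> x = Sum_any f"
  have sub: "{d. f d \<noteq> 0} \<subseteq> deg ` T"
  proof
    fix d assume "d \<in> {d. f d \<noteq> 0}"
    then have "f d \<noteq> 0" by simp
    then obtain t where "t \<in> {t\<in>T. deg t = d}"
      unfolding f_def by (rule sum.not_neutral_contains_not_neutral)
    then show "d \<in> deg ` T" by auto
  qed
  have "f d \<in> Vgr d" for d
    unfolding f_def by (intro subspace_sum subspace_scale graded_subspace) (use basis_homogeneous in auto)
  moreover have "finite {d. f d \<noteq> 0}" using sub T(1) by (simp add: finite_subset)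
  moreover have "Sum_any f = x"
  proof -
    have "Sum_any f = sum f (deg ` T)" by (rule Sum_any.expand_superset) (use sub T in auto)
    also have "\<dots> = (\<Sum>t\<in>T. scale (ip x (v t)) (v t))"
      unfolding f_def by (rule sum.image_gen[OF T(1), symmetric])
    finally show ?thesis using T(2) by simp
  qed
  ultimately have "?P f" by auto
  moreover have "?P g"
  proof -
    have "{d. g d \<noteq> 0} \<subseteq> {n}" by (auto simp: g_def)
    then have "finite {d. g d \<noteq> 0}" "Sum_any g = sum g {n}"
      by (auto intro: finite_subset simp: Sum_any.expand_superset[of "{n}" g])
    then show ?thesis using assms(1) graded_subspace by (auto simp: g_def subspace_0)
  qed
  ultimately have "f = g" using graded_decomposition[of x] by blast
  with \<open>deg s \<noteq> n\<close> have "f (deg s) = 0" by (simp add: g_def)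
  then have "ip (f (deg s)) (v s) = 0" using ip_scale_left[of 0 0 "v s"] by simp
  moreover have "ip (f (deg s)) (v s) = ip x (v s)"
    using T(1,3) by (auto simp: f_def ip_sum_left ip_scale_left ip_basis if_distrib cong: if_cong)
  ultimately show False using assms(2) by simp
qed

lemma finite_deg: "finite {t. deg t = n}"
proof -
  obtain S where S: "finite S" "Vgr n \<subseteq> span S" using graded_finite_dim by blast
  have "v ` {t. deg t = n} \<subseteq> span S" using S(2) basis_homogeneous by auto
  moreover have "independent (v ` {t. deg t = n})"
    by (rule independent_mono[OF basis_independent]) auto
  ultimately have "finite (v ` {t. deg t = n})" using independent_span_bound[OF S(1)] by blast
  then show ?thesis by (rule finite_imageD) (rule inj_on_subset[OF basis_inj], simp)
qed

text \<open>Generators of one sign commute, since their indices are never opposite. The values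
  \<open>e = 1\<close> and \<open>e = - 1\<close> will give the two actions.\<close>

lemma heis_action_exists:
  assumes "e \<noteq> 0"
  shows "\<exists>A. symfun_action scale A \<and> (\<forall>n>0. A (p_sym n) = \<rho> (heis_B a (e * int n)))"
proof (rule symfun_action_exists)
  show "vector_space scale" by unfold_locales
  fix k n :: nat and x assume "k > 0" "n > 0"
  then have "e * int k \<noteq> - (e * int n)" using assms
    by (metis add.inverse_inverse mult_cancel_left mult_minus_right of_nat_0_less_iff neg_0_less_iff_less
        not_less_iff_gr_or_eq order_less_trans)
  then show "\<rho> (heis_B a (e * int k)) (\<rho> (heis_B a (e * int n)) x) =
      \<rho> (heis_B a (e * int n)) (\<rho> (heis_B a (e * int k)) x)"
    using rho_commute[of "e * int k" "e * int n" x] assms \<open>k > 0\<close> \<open>n > 0\<close> by simp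
qed (simp_all add: heis_B_def rho_vec_add rho_vec_scale)

end

section \<open>Actions of symmetric functions through generators of one sign\<close>

locale graded_heis_action = graded_heis_rep scale a \<rho> Vgr v deg m ip + symfun_action scale A
  for scale :: "'k::field_char_0 \<Rightarrow> 'v::ab_group_add \<Rightarrow> 'v"
    and a \<rho> Vgr and v :: "'s \<Rightarrow> 'v" and deg m ip A +
  fixes e :: int
  assumes e_nonzero: "e \<noteq> 0"
    and act_p_sym: "n > 0 \<Longrightarrow> A (p_sym n) = \<rho> (heis_B a (e * int n))"
begin

lemma act_p_part:
  assumes "0 \<notin> set \<mu>"
  shows "\<rho> (heis_class a (prod_list (map (\<lambda>i. free_gen (e * int i)) \<mu>))) x = A (p_mset (mset \<mu>)) x"
  using assms by (induction \<mu>) (auto simp: rho_1 act_one rho_mult act_mult act_p_sym heis_B_def)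

text \<open>The power sum expansion of \<open>h_sym k\<close> has the coefficients that define
  \<open>heis_D\<close> and \<open>heis_U\<close>, so the operator is \<open>D_k\<close> for
  \<open>e = 1\<close> and \<open>U_k\<close> for \<open>e = - 1\<close>.\<close>

lemma act_h_sym:
  "A (h_sym k) = \<rho> (heis_class a (\<Sum>\<mu>\<in>partitions_of k.
     free_const (inverse (of_nat (z_part \<mu>))) * prod_list (map (\<lambda>i. free_gen (e * int i)) \<mu>)))"
proof
  fix x
  have "A (h_sym k) x = (\<Sum>M\<in>mset_partitions k. scale (inverse (of_nat (z_mset M))) (A (p_mset M) x))"
    by (simp add: h_sym_p_mset act_sum_left act_scale_left)
  also have "\<dots> = (\<Sum>\<mu>\<in>partitions_of k. scale (inverse (of_nat (z_part \<mu>))) (A (p_mset (mset \<mu>)) x))"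
    unfolding z_part_mset by (rule sum.reindex_bij_betw[OF bij_betw_partitions_of, symmetric])
  also have "\<dots> = \<rho> (heis_class a (\<Sum>\<mu>\<in>partitions_of k.
     free_const (inverse (of_nat (z_part \<mu>))) * prod_list (map (\<lambda>i. free_gen (e * int i)) \<mu>))) x"
    unfolding rho_sum
    by (intro sum.cong refl)
       (auto simp: rho_mult rho_const act_p_part partitions_of_def is_partition_0_notin)
  finally show "A (h_sym k) x = \<rho> (heis_class a (\<Sum>\<mu>\<in>partitions_of k.
     free_const (inverse (of_nat (z_part \<mu>))) * prod_list (map (\<lambda>i. free_gen (e * int i)) \<mu>))) x" .
qed

lemma act_p_mset_graded:
  assumes "0 \<notin># M" "x \<in> Vgr n"
  shows "A (p_mset M) x \<in> Vgr (n - m * e * int (sum_mset M))"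
  using assms(1)
proof (induction M)
  case (add k M)
  then have k: "k > 0" by auto
  have "\<rho> (heis_B a (e * int k)) (A (p_mset M) x) \<in> Vgr (n - m * e * int (sum_mset M) - m * (e * int k))"
    using add e_nonzero k by (intro rep_graded) auto
  then show ?case by (simp add: act_mult act_p_sym[OF k] algebra_simps)
qed (simp add: act_one assms)

lemma act_h_sym_graded:
  assumes "x \<in> Vgr n"
  shows "A (h_sym k) x \<in> Vgr (n - m * e * int k)"
  unfolding h_sym_p_mset act_sum_left act_scale_left
  by (intro subspace_sum subspace_scale graded_subspace)
     (use act_p_mset_graded[OF _ assms] in \<open>auto simp: mset_partitions_def\<close>)

text \<open>Homogeneity fixes the degree of \<open>t\<close>, and each degree has finitely many
  basis vectors. Hence the sums over \<open>t\<close> in the identities for \<open>F\<close> are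
  finite.\<close>

lemma finite_act_h_sym: "finite {t. ip (A (h_sym k) (v t)) (v s) \<noteq> 0}"
proof (rule finite_subset)
  show "{t. ip (A (h_sym k) (v t)) (v s) \<noteq> 0} \<subseteq> {t. deg t = deg s + m * e * int k}"
    using ip_deg[OF act_h_sym_graded[OF basis_homogeneous]] by force
qed (rule finite_deg)

text \<open>Degrees allow \<open>p_mset M\<close> to contribute for only one value of
  \<open>sum_mset M\<close>, so the functional has finite support and some \<open>u\<close>
  represents it. By \<open>hall_inner_h_expo\<close> the given series consists of the coefficients
  of \<open>u\<close>, and thus is a symmetric function.\<close>

lemma skew_represent:
  "\<exists>u. (\<forall>f. hall_inner u f = ip (A f (v s)) (v t)) \<and>
     u = Abs_symfun (\<lambda>\<alpha>. ip (fold (\<lambda>i. A (h_sym (Poly_Mapping.lookup \<alpha> i)))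
       [0..<Poly_Mapping.degree \<alpha>] (v s)) (v t))"
proof -
  let ?S = "{M. 0 \<notin># M \<and> ip (A (p_mset M) (v s)) (v t) \<noteq> 0}"
  have deg: "deg t = deg s - m * e * int (sum_mset M)" if "M \<in> ?S" for M
    using that ip_deg[OF act_p_mset_graded[OF _ basis_homogeneous]] by blast
  have "sum_mset M = sum_mset N" if "M \<in> ?S" "N \<in> ?S" for M N
  proof -
    have "m * e * int (sum_mset M) = m * e * int (sum_mset N)"
      using deg[OF that(1)] deg[OF that(2)] by linarith
    then have "int (sum_mset M) = int (sum_mset N)"
      using e_nonzero shift_nonzero by (metis mult_cancel_left mult_eq_0_iff)
    then show ?thesis by (simp only: of_nat_eq_iff)
  qed
  then have "\<exists>d. ?S \<subseteq> {M. 0 \<notin># M \<and> sum_mset M \<le> d}"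
    by (cases "?S = {}") (blast, metis (mono_tags, lifting) all_not_in_conv mem_Collect_eq order_refl subsetI)
  then have "finite ?S" using finite_msets_sum_le finite_subset by blast
  then obtain u where u: "\<And>f. hall_inner u f = ip (A f (v s)) (v t)"
    using hall_inner_represent[of "\<lambda>f. ip (A f (v s)) (v t)"]
    by (auto simp: act_simps ip_add_left ip_scale_left)
  moreover have "symfun_coeff u = (\<lambda>\<alpha>. ip (fold (\<lambda>i. A (h_sym (Poly_Mapping.lookup \<alpha> i)))
       [0..<Poly_Mapping.degree \<alpha>] (v s)) (v t))"
    by (rule ext) (simp only: act_fold_h_expo u[symmetric] hall_inner_h_expo)
  ultimately show ?thesis by (metis symfun_coeff_inverse)
qed

text \<open>\<open>A f\<close> is a polynomial in the generators \<open>B\<^sub>e\<^sub>j\<close>, and bracketing with \<open>B\<^sub>-\<^sub>e\<^sub>n\<close> is a derivation.\<close>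

lemma act_commute:
  assumes n: "n > 0"
  shows "A f (\<rho> (heis_B a (- (e * int n))) x) =
    \<rho> (heis_B a (- (e * int n))) (A f x) + scale (of_int e * a (e * int n)) (A (p_deriv n f) x)"
proof (induction f rule: symfun_p_induct)
  case (p_mset M)
  let ?B = "\<rho> (heis_B a (- (e * int n)))"
  have B_add: "?B (y + z) = ?B y + ?B z" and B_scale: "?B (scale c y) = scale c (?B y)" for y z c
    by (simp_all add: heis_B_def rho_vec_add rho_vec_scale)
  from p_mset show ?case
  proof (induction M arbitrary: x)
    case (add k M)
    then have k: "k > 0" by auto
    have "p_deriv n (p_sym k :: 'k symfun) = (if k = n then symfun_scale (of_nat n) 1 else 0)"
      using p_deriv_p_mset[of "{#k#}" n] k by (auto split: if_splits)
    \<comment> \<open>For \<open>k = n\<close> the Heisenberg relation yields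
      \<open>e * n * a (e * n)\<close>; its factor \<open>n\<close> is already supplied by
      \<open>p_deriv n (p_sym n)\<close>.\<close>
    then have 1: "A (p_sym k) (?B y) = ?B (A (p_sym k) y) +
        scale (of_int e * a (e * int n)) (A (p_deriv n (p_sym k)) y)" for y
      using rho_commute[of "e * int k" "- (e * int n)" y] k n e_nonzero
      by (auto simp: act_p_sym act_simps mult_ac)
    show ?case using add
      by (simp add: act_mult 1 p_deriv_mult act_simps scale_right_distrib)
  qed (simp add: act_one)
qed (simp_all add: p_deriv_add p_deriv_scale act_simps heis_B_def rho_vec_add rho_vec_scale
    scale_right_distrib mult_ac)

end


section \<open>The four identities\<close>

lemma hall_inner_Sum_any:
  assumes "finite T" "\<And>t. t \<notin> T \<Longrightarrow> c t = 0"
  shows "hall_inner (Sum_any (\<lambda>t. symfun_scale (c t) (g t))) f = (\<Sum>t\<in>T. c t * hall_inner (g t) f)"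
proof -
  have "Sum_any (\<lambda>t. symfun_scale (c t) (g t)) = (\<Sum>t\<in>T. symfun_scale (c t) (g t))"
    using assms by (intro Sum_any.expand_superset) auto
  then show ?thesis by (simp add: hall_inner_sum_left hall_inner_scale_left)
qed

theorem theorem7:
  fixes scale :: "'k::field_char_0 \<Rightarrow> 'v::ab_group_add \<Rightarrow> 'v"
    and a :: "int \<Rightarrow> 'k"
    and \<rho> :: "'k free_heis set \<Rightarrow> 'v \<Rightarrow> 'v"
    and Vgr :: "int \<Rightarrow> 'v set"
    and v :: "'s \<Rightarrow> 'v"
    and deg :: "'s \<Rightarrow> int"
    and m :: int
    and ip :: "'v \<Rightarrow> 'v \<Rightarrow> 'k"
    and b s :: 's
    and k :: nat
    and F G :: "'s \<Rightarrow> 'k symfun"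
  assumes a_nonzero: "\<And>j. j \<noteq> 0 \<Longrightarrow> a j \<noteq> 0"
    and a_sym: "\<And>j. j \<noteq> 0 \<Longrightarrow> a j = a (- j)"
    and rep: "graded_heis_rep scale a \<rho> Vgr v deg m ip"
    and hw: "highest_weight a \<rho> (v b)"
    and F_def: "\<And>t. F t = F_skew a \<rho> ip v t b"
    and G_def: "\<And>t. G t = G_skew a \<rho> ip v t b"
    and k: "k \<ge> 1"
  shows "(dual_highest_weight a \<rho> ip (v b) \<longrightarrow>
           plethysm_hom a (h_sym k) * G s =
             Sum_any (\<lambda>t. symfun_scale (ip (\<rho> (heis_U a k) (v s)) (v t)) (G t))) \<and>
         plethysm_hom a (h_sym k) * F s =
           Sum_any (\<lambda>t. symfun_scale (ip (\<rho> (heis_D a k) (v t)) (v s)) (F t)) \<and>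
         h_perp k (G s) =
           Sum_any (\<lambda>t. symfun_scale (ip (\<rho> (heis_D a k) (v s)) (v t)) (G t)) \<and>
         h_perp k (F s) =
           Sum_any (\<lambda>t. symfun_scale (ip (\<rho> (heis_U a k) (v t)) (v s)) (F t))"
proof -
  interpret graded_heis_rep scale a \<rho> Vgr v deg m ip by (rule rep)
  obtain P where P: "symfun_action scale P" "\<And>n. n > 0 \<Longrightarrow> P (p_sym n) = \<rho> (heis_B a (1 * int n))"
    using heis_action_exists[of 1] by auto
  obtain N where N: "symfun_action scale N" "\<And>n. n > 0 \<Longrightarrow> N (p_sym n) = \<rho> (heis_B a (- 1 * int n))"
    using heis_action_exists[of "- 1"] by auto
  interpret P: symfun_action scale P by (rule P(1))
  interpret N: symfun_action scale N by (rule N(1))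
  interpret P: graded_heis_action scale a \<rho> Vgr v deg m ip P 1
    by unfold_locales (simp_all add: P(2))
  interpret N: graded_heis_action scale a \<rho> Vgr v deg m ip N "- 1"
    by unfold_locales (simp_all add: N(2))
  have P_p: "P (p_sym n) = \<rho> (heis_B a (int n))" and N_p: "N (p_sym n) = \<rho> (heis_B a (- int n))"
    if "n > 0" for n
    using P(2)[OF that] N(2)[OF that] by simp_all
  have D: "\<rho> (heis_D a j) = P (h_sym j)" and U: "\<rho> (heis_U a j) = N (h_sym j)" for j
    using P.act_h_sym[of j] N.act_h_sym[of j] by (simp_all add: heis_D_def heis_U_def)
  have G: "hall_inner (G t) f = ip (P f (v t)) (v b)" for t f
    using P.skew_represent[of t b] unfolding G_def G_skew_def D by auto
  have F: "hall_inner (F t) f = ip (N f (v b)) (v t)" for t f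
    using N.skew_represent[of b t] unfolding F_def F_skew_def U by auto
  have hw_P: "\<rho> (heis_B a (int n)) (v b) = 0" if "n > 0" for n
    using hw that by (simp add: highest_weight_def)
  have B_lin: "\<rho> (heis_B a j) (x + y) = \<rho> (heis_B a j) x + \<rho> (heis_B a j) y"
    "\<rho> (heis_B a j) (scale c x) = scale c (\<rho> (heis_B a j) x)" for j x y c
    by (simp_all add: heis_B_def rho_vec_add rho_vec_scale)

  \<comment> \<open>Arbitrary \<open>g\<close> and \<open>f\<close> are needed for the induction:
    each factor \<open>p_sym n\<close> split off \<open>g\<close> passes to \<open>f\<close> as
    \<open>p_deriv n\<close>.\<close>
  have plethysm_G: "hall_inner (plethysm_hom a g * G s) f = ip (P f (N g (v s))) (v b)"
    if dual: "dual_highest_weight a \<rho> ip (v b)" for f g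
  proof (induction g arbitrary: f rule: symfun_p_induct)
    case (p_mset M)
    then show ?case
    proof (induction M arbitrary: f)
      case empty
      show ?case by (simp add: plethysm_hom_1 N.act_one G)
    next
      case (add n M)
      then have n: "n > 0" by auto
      let ?x = "N (p_mset M) (v s)"
      have "hall_inner (plethysm_hom a (p_mset (add_mset n M)) * G s) f =
          a (int n) * hall_inner (plethysm_hom a (p_mset M) * G s) (p_deriv n f)"
        by (simp add: plethysm_hom_mult plethysm_hom_p_sym[OF n] symfun_scale_mult_left
            hall_inner_scale_left hall_inner_p_times[OF n] mult.assoc)
      also have "\<dots> = a (int n) * ip (P (p_deriv n f) ?x) (v b)"
        using add by simp
      \<comment> \<open>Moving \<open>B_{-n}\<close> to the left of \<open>P f\<close> produces the
        derivative term; the other term lies in the image of \<open>B_{-n}\<close> and is orthogonal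
        to \<open>v b\<close>.\<close>
      also have "\<dots> = ip (P f (\<rho> (heis_B a (- int n)) ?x)) (v b)"
        using P.act_commute[OF n, of f ?x] dual n
        by (simp add: ip_add_left ip_scale_left dual_highest_weight_def)
      finally show ?case by (simp add: N.act_mult N_p[OF n])
    qed
  qed (simp_all add: plethysm_hom_add plethysm_hom_scale distrib_right symfun_scale_mult_left
      hall_inner_simps N.act_simps P.act_simps ip_add_left ip_scale_left)

  have plethysm_F: "hall_inner (plethysm_hom a g * F s) f = ip (P g (N f (v b))) (v s)" for f g
  proof (induction g arbitrary: f rule: symfun_p_induct)
    case (p_mset M)
    then show ?case
    proof (induction M arbitrary: f)
      case empty
      show ?case by (simp add: plethysm_hom_1 P.act_one F)
    next
      case (add n M)
      then have n: "n > 0" by auto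
      have "N f (\<rho> (heis_B a (int n)) (v b)) = 0"
        using N.act_scale_right[of f 0 0] by (simp add: hw_P[OF n])
      \<comment> \<open>In \<open>act_commute\<close> with \<open>e = - 1\<close> the left side
        vanishes; solving for the first term on the right turns the sign into plus, and
        \<open>a_sym\<close> replaces \<open>a (- int n)\<close>.\<close>
      then have B: "\<rho> (heis_B a (int n)) (N f (v b)) = scale (a (int n)) (N (p_deriv n f) (v b))"
        using N.act_commute[OF n, of f "v b"] a_sym[of "int n"] n by simp
      have "hall_inner (plethysm_hom a (p_mset (add_mset n M)) * F s) f =
          a (int n) * hall_inner (plethysm_hom a (p_mset M) * F s) (p_deriv n f)"
        by (simp add: plethysm_hom_mult plethysm_hom_p_sym[OF n] symfun_scale_mult_left
            hall_inner_scale_left hall_inner_p_times[OF n] mult.assoc)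
      also have "\<dots> = a (int n) * ip (P (p_mset M) (N (p_deriv n f) (v b))) (v s)"
        using add by simp
      \<comment> \<open>With \<open>p_sym n\<close> as last factor, \<open>B_n\<close> acts first,
        directly on \<open>N f (v b)\<close>.\<close>
      also have "\<dots> = ip (P (p_mset M * p_sym n) (N f (v b))) (v s)"
        by (simp add: P.act_mult P_p[OF n] B P.act_scale_right ip_scale_left)
      finally show ?case by (simp add: mult.commute)
    qed
  qed (simp_all add: plethysm_hom_add plethysm_hom_scale distrib_right symfun_scale_mult_left
      hall_inner_simps P.act_simps ip_add_left ip_scale_left)

  have sum_G: "hall_inner (Sum_any (\<lambda>t. symfun_scale (ip x (v t)) (G t))) f = ip (P f x) (v b)" for x f
  proof -
    obtain T where T: "finite T" "\<And>t. t \<notin> T \<Longrightarrow> ip x (v t) = 0"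
      by (rule basis_expansion[of x]) blast
    have "ip (P f x) (v b) = (\<Sum>t\<in>T. ip x (v t) * ip (P f (v t)) (v b))"
      by (rule functional_expansion) (use T in \<open>auto simp: P.act_simps ip_add_left ip_scale_left\<close>)
    then show ?thesis using T by (simp add: hall_inner_Sum_any[of T] G)
  qed
  \<comment> \<open>In contrast to \<open>sum_G\<close>, the index \<open>t\<close> sits inside the
    argument of the operator, so the coefficients are values of a functional \<open>L\<close> and
    the expanded vector is \<open>N f (v b)\<close>.\<close>
  have sum_F: "hall_inner (Sum_any (\<lambda>t. symfun_scale (L (v t)) (F t))) f = L (N f (v b))"
    if L: "\<And>x y. L (x + y) = L x + L y" "\<And>c x. L (scale c x) = c * L x" "finite {t. L (v t) \<noteq> 0}" for L f
  proof -
    have "L (N f (v b)) = (\<Sum>t\<in>{t. L (v t) \<noteq> 0}. ip (N f (v b)) (v t) * L (v t))"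
      by (rule functional_expansion[OF L(1,2)]) (use L(3) in auto)
    then show ?thesis
      using hall_inner_Sum_any[OF L(3), of "\<lambda>t. L (v t)" F f] by (simp add: F mult.commute)
  qed
  have sum_F_D: "hall_inner (Sum_any (\<lambda>t. symfun_scale (ip (P (h_sym k) (v t)) (v s)) (F t))) f =
      ip (P (h_sym k) (N f (v b))) (v s)" for f
    by (rule sum_F) (simp_all add: P.act_simps ip_add_left ip_scale_left P.finite_act_h_sym)
  have sum_F_U: "hall_inner (Sum_any (\<lambda>t. symfun_scale (ip (N (h_sym k) (v t)) (v s)) (F t))) f =
      ip (N (h_sym k) (N f (v b))) (v s)" for f
    by (rule sum_F) (simp_all add: N.act_simps ip_add_left ip_scale_left N.finite_act_h_sym)

  show ?thesis
    unfolding D U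
  proof (intro conjI impI; rule hall_inner_eqI)
    fix f
    show "hall_inner (plethysm_hom a (h_sym k) * G s) f =
        hall_inner (Sum_any (\<lambda>t. symfun_scale (ip (N (h_sym k) (v s)) (v t)) (G t))) f"
      if "dual_highest_weight a \<rho> ip (v b)"
      by (simp add: plethysm_G[OF that] sum_G)
    show "hall_inner (plethysm_hom a (h_sym k) * F s) f =
        hall_inner (Sum_any (\<lambda>t. symfun_scale (ip (P (h_sym k) (v t)) (v s)) (F t))) f"
      by (simp add: plethysm_F sum_F_D)
    \<comment> \<open>The adjoint yields the action of \<open>h_sym k * f\<close> on
      \<open>v s\<close>, the sum that of \<open>f * h_sym k\<close>; commutativity identifies
      them.\<close>
    show "hall_inner (h_perp k (G s)) f =
        hall_inner (Sum_any (\<lambda>t. symfun_scale (ip (P (h_sym k) (v s)) (v t)) (G t))) f"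
      by (simp add: hall_inner_h_perp G sum_G P.act_mult[symmetric] mult.commute)
    show "hall_inner (h_perp k (F s)) f =
        hall_inner (Sum_any (\<lambda>t. symfun_scale (ip (N (h_sym k) (v t)) (v s)) (F t))) f"
      by (simp add: hall_inner_h_perp F sum_F_U N.act_mult)
  qed
qed

end
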